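(* If $G$ is a $4$-irregular graph, then $\chi_l(G^2) \leq 11$.
   Context: All graphs are finite and simple. A graph $G$ is $k$-irregular if its maximum degree is $\Delta(G)=k$ and no two vertices of degree $k$ are adjacent in $G$. The square $G^2$ of $G$ is the graph obtained from $G$ by adding an edge between any two vertices at distance $2$ in $G$. A list assignment $L$ of a graph $H$ assigns to each vertex $v$ a set $L(v)$ of permissible colors; $H$ is $L$-colorable if there is a proper coloring $f$ of $H$ with $f(v)\in L(v)$ for every vertex $v$. $H$ is $k$-choosable if it is $L$-colorable for every list assignment $L$ in which each $L(v)$ has exactly $k$ colors. The list chromatic number $\chi_l(H)$ is the smallest integer $k$ for which $H$ is $k$-choosable. *)

theory Defs
  imports "Graph_Theory.Pair_Digraph" "Graph_Theory.Shortest_Path"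
begin

text \<open>
  A finite simple graph is a \<^locale>\<open>pair_graph\<close>: a finite vertex set with a symmetric,
  irreflexive set of vertex pairs. Each edge is represented by its two orientations, so the
  degree of a vertex is its out-degree.
\<close>

abbreviation degree :: "'a pair_pre_digraph \<Rightarrow> 'a \<Rightarrow> nat" where
  "degree G v \<equiv> out_degree (with_proj G) v"

text \<open>The inserted \<open>0\<close> only gives the graph without vertices maximum degree \<open>0\<close>.\<close>

definition max_degree :: "'a pair_pre_digraph \<Rightarrow> nat" where
  "max_degree G = Max (insert 0 (degree G ` pverts G))"

definition irregular :: "nat \<Rightarrow> 'a pair_pre_digraph \<Rightarrow> bool" where
  "irregular k G \<longleftrightarrow> max_degree G = k \<and>
     (\<forall>u \<in> pverts G. \<forall>v \<in> pverts G. degree G u = k \<and> degree G v = k \<longrightarrow> (u, v) \<notin> parcs G)"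

text \<open>
  The number of edges of a shortest walk, that is, the library's shortest path cost for unit
  weights (\<open>\<infinity>\<close> if there is no walk).
\<close>

definition distance :: "'a pair_pre_digraph \<Rightarrow> 'a \<Rightarrow> 'a \<Rightarrow> ereal" where
  "distance G u v = wf_digraph.\<mu> (with_proj G) (\<lambda>_. 1) u v"

definition square :: "'a pair_pre_digraph \<Rightarrow> 'a pair_pre_digraph" where
  "square G = \<lparr> pverts = pverts G,
     parcs = parcs G \<union> {(u, v). u \<in> pverts G \<and> v \<in> pverts G \<and> distance G u v = 2} \<rparr>"

definition proper_coloring :: "'a pair_pre_digraph \<Rightarrow> ('a \<Rightarrow> 'c) \<Rightarrow> bool" where
  "proper_coloring H f \<longleftrightarrow> (\<forall>(u, v) \<in> parcs H. f u \<noteq> f v)"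

definition list_colorable :: "'a pair_pre_digraph \<Rightarrow> ('a \<Rightarrow> 'c set) \<Rightarrow> bool" where
  "list_colorable H L \<longleftrightarrow> (\<exists>f. proper_coloring H f \<and> (\<forall>v \<in> pverts H. f v \<in> L v))"

text \<open>
  Colors are natural numbers. This is no restriction for finite graphs, see
  \<open>choosable_any_colors\<close> below. The finiteness condition matters only for \<open>k = 0\<close>, as
  \<^const>\<open>card\<close> is \<open>0\<close> on infinite sets.
\<close>

definition choosable :: "nat \<Rightarrow> 'a pair_pre_digraph \<Rightarrow> bool" where
  "choosable k H \<longleftrightarrow>
     (\<forall>L :: 'a \<Rightarrow> nat set. (\<forall>v \<in> pverts H. finite (L v) \<and> card (L v) = k) \<longrightarrow> list_colorable H L)"

definition list_chromatic_number :: "'a pair_pre_digraph \<Rightarrow> nat" where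
  "list_chromatic_number H = (LEAST k. choosable k H)"

lemma choosable_any_colors:
  fixes L :: "'a \<Rightarrow> 'c set"
  assumes "pair_graph H" "choosable k H"
    and L: "\<And>v. v \<in> pverts H \<Longrightarrow> finite (L v) \<and> card (L v) = k"
  shows "list_colorable H L"
proof -
  interpret pair_graph H by fact
  define C where "C = (\<Union>v \<in> pverts H. L v)"
  have "finite C"
    unfolding C_def using pair_finite_verts L by blast
  then obtain g :: "'c \<Rightarrow> nat" where g: "inj_on g C"
    using finite_imp_inj_to_nat_seg by metis
  have sub: "L v \<subseteq> C" if "v \<in> pverts H" for v
    unfolding C_def using that by blast
  have "finite (g ` L v) \<and> card (g ` L v) = k" if "v \<in> pverts H" for v
    using L[OF that] card_image[OF inj_on_subset[OF g sub[OF that]]] by simp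
  with assms(2) have "list_colorable H (\<lambda>v. g ` L v)"
    unfolding choosable_def by simp
  then obtain f where f: "proper_coloring H f" "\<And>v. v \<in> pverts H \<Longrightarrow> f v \<in> g ` L v"
    unfolding list_colorable_def by blast
  have "\<forall>v \<in> pverts H. \<exists>c. c \<in> L v \<and> g c = f v"
    using f(2) by fastforce
  then have "\<exists>f'. \<forall>v \<in> pverts H. f' v \<in> L v \<and> g (f' v) = f v"
    by (rule bchoice)
  then obtain f' where f': "\<And>v. v \<in> pverts H \<Longrightarrow> f' v \<in> L v \<and> g (f' v) = f v"
    by blast
  have "proper_coloring H f'"
    unfolding proper_coloring_def
  proof (clarify)
    fix u v assume uv: "(u, v) \<in> parcs H" "f' u = f' v"
    then have "f u = f v"
      using f'[OF in_arcsD1[OF uv(1)]] f'[OF in_arcsD2[OF uv(1)]] by simp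
    then show False
      using f(1) uv(1) unfolding proper_coloring_def by blast
  qed
  moreover have "\<forall>v \<in> pverts H. f' v \<in> L v"
    using f' by simp
  ultimately show ?thesis
    unfolding list_colorable_def by (intro exI conjI)
qed

lemma (in pair_graph) distance_eq_2_iff:
  "distance G u v = 2 \<longleftrightarrow> u \<noteq> v \<and> (u, v) \<notin> parcs G \<and> (\<exists>w. (u, w) \<in> parcs G \<and> (w, v) \<in> parcs G)"
proof -
  have cost: "awalk_cost (\<lambda>_. 1) p = real (length p)" for p :: "('a \<times> 'a) list"
    unfolding awalk_cost_def by (induct p) auto
  have d: "distance G u v = (INF p \<in> {p. awalk u p v}. ereal (real (length p)))"
    unfolding distance_def \<mu>_def cost ..
  have le: "distance G u v \<le> ereal (real (length p))" if "awalk u p v" for p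
    unfolding d using that by (auto intro: INF_lower2)
  have attained: "\<exists>p. awalk u p v \<and> distance G u v = ereal (real (length p))"
    if "awalk u p0 v" for p0
  proof -
    obtain p where p: "awalk u p v" "\<And>q. awalk u q v \<Longrightarrow> length p \<le> length q"
      using ex_has_least_nat[of "\<lambda>p. awalk u p v" p0 length] \<open>awalk u p0 v\<close> by blast
    have "distance G u v = ereal (real (length p))"
      unfolding d using p by (intro antisym INF_greatest INF_lower2[of p]) auto
    with p show ?thesis by blast
  qed
  have ex: "\<exists>p. awalk u p v \<and> distance G u v = ereal (real (length p))" if "distance G u v = 2"
  proof -
    have "\<exists>p. awalk u p v"
    proof (rule ccontr)
      assume "\<nexists>p. awalk u p v"
      then have "distance G u v = \<infinity>" unfolding d by (simp add: top_ereal_def)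
      with that show False by simp
    qed
    then show ?thesis using attained by blast
  qed
  have two: "(2::ereal) = ereal (real 2)" by simp
  show ?thesis
  proof (intro iffI conjI)
    assume a: "distance G u v = 2"
    then obtain p where p: "awalk u p v" "length p = 2"
      using ex unfolding two by auto
    then obtain e1 e2 where "p = [e1, e2]"
      by (auto simp: length_Suc_conv numeral_2_eq_2)
    with p show "\<exists>w. (u, w) \<in> parcs G \<and> (w, v) \<in> parcs G"
      by (cases e1; cases e2) (auto simp: awalk_def)
    have "u \<in> pverts G" using p by (auto simp: awalk_def)
    then show "u \<noteq> v"
      using a le[of "[]"] by (auto simp: awalk_def)
    show "(u, v) \<notin> parcs G"
      using a le[of "[(u, v)]"] in_arcsD1 by (auto simp: awalk_def)
  next
    assume b: "u \<noteq> v \<and> (u, v) \<notin> parcs G \<and> (\<exists>w. (u, w) \<in> parcs G \<and> (w, v) \<in> parcs G)"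
    then obtain w where w: "(u, w) \<in> parcs G" "(w, v) \<in> parcs G" by blast
    then have w2: "awalk u [(u, w), (w, v)] v"
      using in_arcsD1 by (auto simp: awalk_def)
    obtain p where p: "awalk u p v" "distance G u v = ereal (real (length p))"
      using attained[OF w2] by blast
    have "length p \<le> 2" using le[OF w2] p(2) by simp
    moreover have "length p \<noteq> 0" using p(1) b by (auto simp: awalk_def)
    moreover have "length p \<noteq> 1" using p(1) b by (auto simp: awalk_def length_Suc_conv)
    ultimately have "length p = 2" by linarith
    then show "distance G u v = 2" using p(2) by simp
  qed
qed

lemma (in pair_graph) pair_graph_square: "pair_graph (square G)"
proof -
  have flip: "(u, v) \<in> parcs G \<longleftrightarrow> (v, u) \<in> parcs G" for u v
    using pair_sym_arcs by (auto simp: symmetric_def sym_def)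
  have nonrefl: "(u, u) \<notin> parcs G" "distance G u u \<noteq> 2" for u
    unfolding distance_eq_2_iff using pair_no_loops[of "(u, u)"] by auto
  have "distance G u v = 2 \<longleftrightarrow> distance G v u = 2" for u v
    unfolding distance_eq_2_iff using flip by metis
  moreover have sub: "parcs (square G) \<subseteq> pverts G \<times> pverts G"
    unfolding square_def using in_arcsD1 in_arcsD2 by auto
  moreover have "finite (parcs (square G))"
    using finite_subset[OF sub] pair_finite_verts by blast
  moreover have "sym (parcs (square G))"
    unfolding square_def sym_def using flip calculation(1) by simp
  moreover have "fst e \<noteq> snd e" if "e \<in> parcs (square G)" for e
    using that nonrefl unfolding square_def by (cases e) auto
  moreover have "pverts (square G) = pverts G"
    by (simp add: square_def)
  ultimately show ?thesis
    using sub pair_finite_verts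
    by unfold_locales (auto simp: symmetric_def)
qed

end

theory Submission
  imports Defs
begin

text \<open>
  Let every list have 11 colours. In the square, a vertex of degree 4 has at most \<open>4 \<cdot> 3\<close>
  neighbours because its neighbours have degree at most 3, and a vertex of degree at most 3 has at
  most \<open>3 \<cdot> 4\<close>. So square degrees are at most 12, two more than a greedy colouring with 11 colours
  can afford.

  Greedy colouring still does almost everything. In a connected graph, colour towards a set \<open>H\<close>
  without isolated vertices: if \<open>x\<close> comes immediately before a set containing \<open>H\<close> in which it has
  a neighbour \<open>y\<close>, then \<open>y\<close> and a further neighbour of \<open>y\<close> in that set are two square neighbours
  of \<open>x\<close> that are still uncoloured, so at most 10 colours are forbidden at \<open>x\<close>
  (\<open>extend_along_growth\<close>). Hence only a small kernel \<open>H\<close> matters. If in the end two square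
  neighbours are left, the first is short of one colour and the second of two. A vertex can be
  compensated in two ways: its square degree may be below 12, or a set of its square neighbours
  can be coloured so that fewer different colours of its list are used.

  Low square degrees come from neighbouring vertices of degree at most 3 and from short cycles. In
  an uncolourable component they force minimum degree 3 and exclude triangles, and a vertex of
  degree 3 has at most one neighbour of degree 3. For 4-cycles and 5-cycles the two last vertices
  each gain one colour from their degrees, and one more colour is gained in their common square
  neighbourhood: either two vertices of an independent set in it share an available colour, or
  their lists are so large together that one of them contains a colour missing in the list of the
  last vertex (\<open>no_reducible_kernel\<close>).

  In girth at least 6, take an edge \<open>ab\<close> with \<open>deg a = 4\<close>, let \<open>x1, x2\<close> be two of the three other
  neighbours of \<open>a\<close> and \<open>y1, y2\<close> the two other neighbours of \<open>b\<close>. Each \<open>xi\<close> is at distance 3 from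
  each \<open>yj\<close>, so they may share colours, and since their lists are as large as those of \<open>a\<close> and
  \<open>b\<close>, these four vertices can be coloured first so that \<open>a\<close> and \<open>b\<close> gain enough. For the greedy
  colouring to end in \<open>ab\<close>, the graph without the four vertices must be connected. This is
  arranged by an extremal choice: the connected region around \<open>ab\<close> is taken as large as possible,
  and if it were not everything, a configuration inside the rest would leave a larger region
  (\<open>ex_connected_complement\<close>).
\<close>

section \<open>Two colours against given lists\<close>

text \<open>
  A common colour of \<open>X\<close> and \<open>Y\<close>, used twice, does it. If \<open>X\<close> and \<open>Y\<close> are disjoint, at most one of
  them is contained in \<open>P\<close>, and only if it equals \<open>P\<close>; the other is then disjoint from \<open>P\<close>. The
  same holds for \<open>Q\<close>, and this is enough to serve \<open>P\<close> and \<open>Q\<close> at once.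
\<close>

lemma two_colours_meeting_two_lists_once:
  fixes X Y P Q :: "'c set"
  assumes "finite X" "finite Y" "finite P" "finite Q"
    and "card X = n" "card Y = n" "card P = n" "card Q = n" "n > 0"
  shows "\<exists>x\<in>X. \<exists>y\<in>Y. card ({x, y} \<inter> P) \<le> 1 \<and> card ({x, y} \<inter> Q) \<le> 1"
proof -
  have one: "card ({x, y} \<inter> R) \<le> 1" if "x \<notin> R \<or> y \<notin> R \<or> x = y" for x y :: 'c and R
  proof -
    have "{x, y} \<inter> R \<subseteq> {x} \<or> {x, y} \<inter> R \<subseteq> {y}" using that by blast
    then show ?thesis
      using card_mono[of "{x}" "{x, y} \<inter> R"] card_mono[of "{y}" "{x, y} \<inter> R"] by auto
  qed
  have ne: "X \<noteq> {}" "Y \<noteq> {}" using assms by auto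
  have eq: "A = B" if "A \<subseteq> B" "finite B" "card A = n" "card B = n" for A B :: "'c set"
    using that card_subset_eq by metis
  have "\<exists>x\<in>X. \<exists>y\<in>Y. x = y \<or> (x \<notin> P \<or> y \<notin> P) \<and> (x \<notin> Q \<or> y \<notin> Q)"
  proof (rule ccontr)
    assume "\<not> ?thesis"
    then have bad: "x \<noteq> y \<and> (x \<in> P \<and> y \<in> P \<or> x \<in> Q \<and> y \<in> Q)" if "x \<in> X" "y \<in> Y" for x y
      using that by blast
    have "X \<subseteq> P \<or> Y \<subseteq> Q" "X \<subseteq> Q \<or> Y \<subseteq> P"
      using bad by blast+
    then have "X = P \<or> Y = Q" "X = Q \<or> Y = P"
      using eq[of X P] eq[of Y Q] eq[of X Q] eq[of Y P] assms by blast+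
    then show False
      using bad ne by blast
  qed
  then obtain x y where "x \<in> X" "y \<in> Y" "x = y \<or> (x \<notin> P \<or> y \<notin> P) \<and> (x \<notin> Q \<or> y \<notin> Q)"
    by blast
  then show ?thesis
    using one[of x P y] one[of x Q y] by (intro bexI[of _ x] bexI[of _ y]) auto
qed

lemma two_colours_meeting_list_once:
  assumes "finite X" "finite Y" "finite P" "card P < card X + card Y" "X \<noteq> {}" "Y \<noteq> {}"
  shows "\<exists>x\<in>X. \<exists>y\<in>Y. card ({x, y} \<inter> P) \<le> 1"
proof -
  have "\<exists>x\<in>X. \<exists>y\<in>Y. x = y \<or> x \<notin> P \<or> y \<notin> P"
  proof (rule ccontr)
    assume "\<not> ?thesis"
    then have "X \<inter> Y = {}" "X \<union> Y \<subseteq> P" using assms(5,6) by blast+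
    then show False
      using assms card_Un_disjoint[of X Y] card_mono[of P "X \<union> Y"] by simp
  qed
  then obtain x y where xy: "x \<in> X" "y \<in> Y" "x = y \<or> x \<notin> P \<or> y \<notin> P" by blast
  then have "{x, y} \<inter> P \<subseteq> {x} \<or> {x, y} \<inter> P \<subseteq> {y}" by blast
  then have "card ({x, y} \<inter> P) \<le> 1"
    using card_mono[of "{x}" "{x, y} \<inter> P"] card_mono[of "{y}" "{x, y} \<inter> P"] by auto
  with xy show ?thesis by blast
qed

section \<open>Graphs and their squares\<close>

locale finite_graph =
  fixes V :: "'a set" and E :: "'a \<Rightarrow> 'a \<Rightarrow> bool"
  assumes finite_V: "finite V"
    and E_V: "E u v \<Longrightarrow> u \<in> V"
    and E_sym: "E u v \<Longrightarrow> E v u"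
    and E_irrefl: "\<not> E u u"
begin

definition nbrs :: "'a \<Rightarrow> 'a set" where
  "nbrs v = {u. E v u}"

abbreviation deg :: "'a \<Rightarrow> nat" where
  "deg v \<equiv> card (nbrs v)"

definition sq :: "'a \<Rightarrow> 'a \<Rightarrow> bool" where
  "sq u v \<longleftrightarrow> u \<noteq> v \<and> (E u v \<or> (\<exists>w. E u w \<and> E w v))"

definition sq_nbrs :: "'a \<Rightarrow> 'a set" where
  "sq_nbrs v = {u. sq v u}"

lemma E_V2: "E u v \<Longrightarrow> v \<in> V"
  using E_V E_sym by blast

lemma sq_sym: "sq u v \<Longrightarrow> sq v u"
  unfolding sq_def using E_sym by blast

lemma sq_edge: "E u v \<Longrightarrow> sq u v"
  unfolding sq_def using E_irrefl by blast

lemma sq_path: "E u w \<Longrightarrow> E w v \<Longrightarrow> u \<noteq> v \<Longrightarrow> sq u v"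
  unfolding sq_def by blast

lemma nbrs_subset: "nbrs v \<subseteq> V"
  unfolding nbrs_def using E_V2 by blast

lemma finite_nbrs [simp]: "finite (nbrs v)"
  using nbrs_subset finite_V finite_subset by blast

lemma sq_nbrs_subset: "sq_nbrs v \<subseteq> V"
  unfolding sq_nbrs_def sq_def using E_V2 by blast

lemma finite_sq_nbrs [simp]: "finite (sq_nbrs v)"
  using sq_nbrs_subset finite_V finite_subset by blast

text \<open>
  A walk \<open>v, y, u\<close> of length two ends in a square neighbour \<open>u\<close> of \<open>v\<close>, and the degenerate walk
  \<open>v, y, v\<close> can stand for the neighbour \<open>y\<close> itself. This reaches every square neighbour, and each
  coincidence of two endpoints, that is, each short cycle through \<open>v\<close>, lowers the degree in the
  square by one.
\<close>

definition walks :: "'a \<Rightarrow> ('a \<times> 'a) set" where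
  "walks v = Sigma (nbrs v) nbrs"

definition endpoint :: "'a \<Rightarrow> 'a \<times> 'a \<Rightarrow> 'a" where
  "endpoint v p = (if snd p = v then fst p else snd p)"

lemma card_sq_nbrs_coincidences:
  assumes X: "X \<subseteq> walks v"
    and "\<And>p. p \<in> X \<Longrightarrow> \<exists>q \<in> walks v - X. endpoint v q = endpoint v p"
  shows "card (sq_nbrs v) + card X \<le> (\<Sum>y\<in>nbrs v. deg y)"
proof -
  have fin: "finite (walks v)"
    unfolding walks_def by simp
  have "sq_nbrs v \<subseteq> endpoint v ` walks v"
  proof
    fix u assume "u \<in> sq_nbrs v"
    then consider "E v u" | w where "E v w" "E w u" "u \<noteq> v"
      unfolding sq_nbrs_def sq_def by blast
    then show "u \<in> endpoint v ` walks v"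
    proof cases
      case 1
      then have "(u, v) \<in> walks v" "endpoint v (u, v) = u"
        unfolding walks_def nbrs_def endpoint_def using E_sym by auto
      then show ?thesis by force
    next
      case 2
      then have "(w, u) \<in> walks v" "endpoint v (w, u) = u"
        unfolding walks_def nbrs_def endpoint_def by auto
      then show ?thesis by force
    qed
  qed
  also have "\<dots> \<subseteq> endpoint v ` (walks v - X)"
  proof
    fix u assume "u \<in> endpoint v ` walks v"
    then obtain p where "p \<in> walks v" "u = endpoint v p" by blast
    then show "u \<in> endpoint v ` (walks v - X)"
      using assms(2)[of p] by (cases "p \<in> X") (metis image_eqI, blast)
  qed
  finally have "card (sq_nbrs v) \<le> card (endpoint v ` (walks v - X))"
    using fin by (intro card_mono) auto
  also have "\<dots> \<le> card (walks v - X)"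
    using fin by (intro card_image_le) auto
  also have "\<dots> = card (walks v) - card X"
    using X fin by (meson card_Diff_subset finite_subset)
  finally have "card (sq_nbrs v) + card X \<le> card (walks v)"
    using X fin card_mono[of "walks v" X] by linarith
  then show ?thesis
    unfolding walks_def by simp
qed

text \<open>
  \<open>grows H W\<close>: the set \<open>W\<close> arises from \<open>H\<close> by repeatedly attaching a vertex along an edge. Reading
  a growth sequence backwards gives the order of the greedy colouring.
\<close>

inductive grows :: "'a set \<Rightarrow> 'a set \<Rightarrow> bool" for H where
  base: "grows H H"
| step: "grows H W \<Longrightarrow> x \<notin> W \<Longrightarrow> y \<in> W \<Longrightarrow> E x y \<Longrightarrow> grows H (insert x W)"

lemma grows_subset: "grows H W \<Longrightarrow> H \<subseteq> W"
  by (induction rule: grows.induct) auto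

lemma grows_step: "grows H W \<Longrightarrow> y \<in> W \<Longrightarrow> E x y \<Longrightarrow> grows H (insert x W)"
  by (cases "x \<in> W") (auto simp: insert_absorb intro: grows.step)

lemma grows_union:
  assumes "grows H W" "grows H' X" "H \<subseteq> X"
  shows "grows H' (W \<union> X)"
  using assms(1)
proof induction
  case base
  then show ?case using assms(2,3) by (simp add: sup.absorb2)
next
  case (step W x y)
  then show ?case using grows_step[of H' "W \<union> X" y x] by simp
qed

lemma grows_no_isolated:
  assumes "grows H W" "\<forall>h\<in>H. \<exists>k\<in>H. E h k"
  shows "\<forall>h\<in>W. \<exists>k\<in>W. E h k"
  using assms by (induction rule: grows.induct) auto

end

text \<open>
  A component of a 4-irregular graph may lack vertices of degree 4, so 4 is only an upper bound
  for the degrees.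
\<close>

locale connected_4_irregular = finite_graph +
  assumes connected: "W \<subseteq> V \<Longrightarrow> W \<noteq> {} \<Longrightarrow> W \<noteq> V \<Longrightarrow> \<exists>x\<in>V - W. \<exists>y\<in>W. E x y"
    and deg_le_4: "deg v \<le> 4"
    and deg_4_independent: "E u v \<Longrightarrow> deg u = 4 \<Longrightarrow> deg v \<noteq> 4"
begin

lemma grows_V:
  assumes "H \<subseteq> V" "H \<noteq> {}"
  shows "grows H V"
proof -
  let ?S = "{W. W \<subseteq> V \<and> grows H W}"
  have "finite ?S"
    using finite_V by simp
  moreover have "H \<in> ?S"
    using assms(1) grows.base by blast
  ultimately obtain W where W: "W \<in> ?S" and max: "\<forall>W'\<in>?S. W \<subseteq> W' \<longrightarrow> W = W'"
    using finite_has_maximal2[of ?S H] by metis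
  have "W = V"
  proof (rule ccontr)
    assume "W \<noteq> V"
    moreover have "W \<noteq> {}"
      using assms(2) grows_subset W by blast
    ultimately obtain x y where xy: "x \<in> V - W" "y \<in> W" "E x y"
      using connected[of W] W by blast
    then have "insert x W \<in> ?S"
      using W grows_step by auto
    with max xy(1) show False
      by blast
  qed
  with W show ?thesis by simp
qed

lemma deg_le_3_if_edge: "E u v \<Longrightarrow> deg u = 4 \<Longrightarrow> deg v \<le> 3"
  using deg_le_4[of v] deg_4_independent[of u v] by linarith

lemma sum_deg_nbrs_le:
  assumes "T \<subseteq> nbrs v" "\<And>y. y \<in> T \<Longrightarrow> deg y \<le> 3"
  shows "(\<Sum>y\<in>nbrs v. deg y) + card T \<le> 4 * deg v"
proof -
  have fin: "finite T" using assms(1) finite_subset by fastforce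
  have "(\<Sum>y\<in>nbrs v. deg y) = (\<Sum>y\<in>T. deg y) + (\<Sum>y\<in>nbrs v - T. deg y)"
    using assms(1) by (simp add: sum.subset_diff)
  moreover have "(\<Sum>y\<in>T. deg y) \<le> 3 * card T"
    using sum_bounded_above[of T deg 3] assms(2) by (simp add: mult.commute)
  moreover have "(\<Sum>y\<in>nbrs v - T. deg y) \<le> 4 * card (nbrs v - T)"
    using sum_bounded_above[of "nbrs v - T" deg 4] deg_le_4 by (simp add: mult.commute)
  moreover have "card (nbrs v - T) + card T = deg v"
    using assms(1) fin card_Diff_subset card_mono[of "nbrs v" T] by fastforce
  ultimately show ?thesis by linarith
qed

text \<open>
  The degree sum over the neighbours of \<open>v\<close> is at most \<open>4 \<cdot> 3\<close> if \<open>deg v = 4\<close>. Otherwise it is at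
  most \<open>3 \<cdot> 4\<close>, and every neighbour of degree at most 3 lowers it by one.
\<close>

lemma card_sq_nbrs_le:
  assumes "X \<subseteq> walks v"
    and "\<And>p. p \<in> X \<Longrightarrow> \<exists>q \<in> walks v - X. endpoint v q = endpoint v p"
  shows "card (sq_nbrs v) + card X \<le> 12"
    and "deg v \<le> 3 \<Longrightarrow> T \<subseteq> nbrs v \<Longrightarrow> (\<And>y. y \<in> T \<Longrightarrow> deg y \<le> 3)
           \<Longrightarrow> card (sq_nbrs v) + card X + card T \<le> 12"
proof -
  note le = card_sq_nbrs_coincidences[OF assms]
  show "card (sq_nbrs v) + card X + card T \<le> 12"
    if "deg v \<le> 3" "T \<subseteq> nbrs v" "\<And>y. y \<in> T \<Longrightarrow> deg y \<le> 3" for T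
    using le sum_deg_nbrs_le[OF that(2,3)] that(1) by linarith
  from this[of "{}"] show "card (sq_nbrs v) + card X \<le> 12"
  proof (cases "deg v = 4")
    case True
    then show ?thesis
      using le sum_deg_nbrs_le[of "nbrs v" v] deg_le_3_if_edge by (auto simp: nbrs_def)
  qed (use deg_le_4[of v] in auto)
qed

lemma card_sq_nbrs_le_12: "card (sq_nbrs v) \<le> 12"
  using card_sq_nbrs_le(1)[of "{}" v] by simp

lemma card_sq_nbrs_le_11:
  assumes "E u v" "deg u \<le> 3" "deg v \<le> 3"
  shows "card (sq_nbrs v) \<le> 11"
proof -
  have "card (sq_nbrs v) + card ({} :: ('a \<times> 'a) set) + card {u} \<le> 12"
    by (intro card_sq_nbrs_le(2)) (use assms E_sym in \<open>auto simp: nbrs_def\<close>)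
  then show ?thesis by simp
qed

lemma card_sq_nbrs_le_10:
  assumes "E u v" "E u' v" "u \<noteq> u'" "deg u \<le> 3" "deg u' \<le> 3" "deg v \<le> 3"
  shows "card (sq_nbrs v) \<le> 10"
proof -
  have "card (sq_nbrs v) + card ({} :: ('a \<times> 'a) set) + card {u, u'} \<le> 12"
    by (intro card_sq_nbrs_le(2)) (use assms E_sym in \<open>auto simp: nbrs_def\<close>)
  then show ?thesis using assms(3) by simp
qed

lemma coincidence_4_cycle:
  assumes "E v y" "E y w" "E w y'" "E y' v" "v \<noteq> w" "y \<noteq> y'"
  shows "{(y, w)} \<subseteq> walks v" "\<And>p. p \<in> {(y, w)} \<Longrightarrow> \<exists>q \<in> walks v - {(y, w)}. endpoint v q = endpoint v p"
proof -
  show "{(y, w)} \<subseteq> walks v"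
    unfolding walks_def nbrs_def using assms by auto
  have "(y', w) \<in> walks v - {(y, w)}" "endpoint v (y', w) = endpoint v (y, w)"
    unfolding walks_def nbrs_def endpoint_def using assms E_sym by auto
  then show "\<exists>q \<in> walks v - {(y, w)}. endpoint v q = endpoint v p" if "p \<in> {(y, w)}" for p
    using that by blast
qed

lemma coincidence_triangle:
  assumes "E v y" "E y w" "E w v"
  shows "{(y, w)} \<subseteq> walks v" "\<And>p. p \<in> {(y, w)} \<Longrightarrow> \<exists>q \<in> walks v - {(y, w)}. endpoint v q = endpoint v p"
proof -
  show "{(y, w)} \<subseteq> walks v"
    unfolding walks_def nbrs_def using assms by auto
  have "(w, v) \<in> walks v - {(y, w)}" "endpoint v (w, v) = endpoint v (y, w)"
    unfolding walks_def nbrs_def endpoint_def using assms E_sym E_irrefl by auto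
  then show "\<exists>q \<in> walks v - {(y, w)}. endpoint v q = endpoint v p" if "p \<in> {(y, w)}" for p
    using that by blast
qed

end

locale list_assignment = connected_4_irregular +
  fixes L :: "'a \<Rightarrow> 'c set"
  assumes finite_L: "v \<in> V \<Longrightarrow> finite (L v)"
    and card_L: "v \<in> V \<Longrightarrow> card (L v) = 11"
begin

definition proper :: "('a \<Rightarrow> 'c) \<Rightarrow> 'a set \<Rightarrow> bool" where
  "proper f D \<longleftrightarrow> (\<forall>x\<in>D. f x \<in> L x) \<and> (\<forall>x\<in>D. \<forall>y\<in>D. sq x y \<longrightarrow> f x \<noteq> f y)"

definition avail :: "('a \<Rightarrow> 'c) \<Rightarrow> 'a set \<Rightarrow> 'a \<Rightarrow> 'c set" where
  "avail f D x = L x - f ` (sq_nbrs x \<inter> D)"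

lemma proper_fun_upd:
  assumes "proper f D" "x \<notin> D" "c \<in> avail f D x"
  shows "proper (f(x := c)) (insert x D)"
proof -
  have c: "c \<in> L x" "\<And>y. y \<in> D \<Longrightarrow> sq x y \<Longrightarrow> c \<noteq> f y"
    using assms(3) unfolding avail_def sq_nbrs_def by auto
  have "\<not> sq x x"
    unfolding sq_def by simp
  then show ?thesis
    using assms(1,2) c sq_sym unfolding proper_def by (metis fun_upd_apply insert_iff)
qed

lemma card_avail:
  assumes "x \<in> V"
  shows "11 \<le> card (avail f D x) + card (sq_nbrs x \<inter> D)"
proof -
  have "card (L x) - card (f ` (sq_nbrs x \<inter> D)) \<le> card (avail f D x)"
    unfolding avail_def by (intro diff_card_le_card_Diff) auto
  moreover have "card (f ` (sq_nbrs x \<inter> D)) \<le> card (sq_nbrs x \<inter> D)"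
    by (intro card_image_le) auto
  ultimately show ?thesis using card_L[OF assms] by linarith
qed

lemma avail_nonempty:
  assumes "x \<in> V" "card (f ` (sq_nbrs x \<inter> D) \<inter> L x) \<le> 10"
  obtains c where "c \<in> avail f D x"
proof -
  have "card (L x - f ` (sq_nbrs x \<inter> D) \<inter> L x) > 0"
    using assms card_L[OF assms(1)] diff_card_le_card_Diff[of "f ` (sq_nbrs x \<inter> D) \<inter> L x" "L x"]
    by simp
  then obtain c where "c \<in> L x - f ` (sq_nbrs x \<inter> D) \<inter> L x"
    by (metis all_not_in_conv card.empty less_nat_zero_code)
  then have "c \<in> avail f D x"
    unfolding avail_def by blast
  then show thesis using that by blast
qed

lemma extend_if_few_coloured:
  assumes "finite X" "X \<subseteq> V" "proper f D" "X \<inter> D = {}"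
    and "\<And>x. x \<in> X \<Longrightarrow> card (sq_nbrs x \<inter> (D \<union> X)) \<le> 10"
  shows "\<exists>g. proper g (D \<union> X) \<and> (\<forall>x\<in>D. g x = f x)"
  using assms
proof (induction X arbitrary: f D rule: finite_induct)
  case empty
  then show ?case by auto
next
  case (insert x X)
  have "card (sq_nbrs x \<inter> D) \<le> card (sq_nbrs x \<inter> (D \<union> insert x X))"
    by (intro card_mono) auto
  with insert.prems(4)[of x] card_avail[of x f D] insert.prems(1)
  have "card (avail f D x) > 0" by auto
  then obtain c where c: "c \<in> avail f D x"
    by (metis all_not_in_conv card.empty less_nat_zero_code)
  have "\<exists>g. proper g (insert x D \<union> X) \<and> (\<forall>z\<in>insert x D. g z = (f(x := c)) z)"
  proof (rule insert.IH)
    show "proper (f(x := c)) (insert x D)"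
      using proper_fun_upd c insert.prems(2,3) by blast
  qed (use insert.prems insert.hyps in auto)
  then show ?case
    using insert.prems(3) by (auto simp: fun_upd_def)
qed

text \<open>
  Each vertex \<open>x\<close> is coloured while the set \<open>W\<close> to which it was attached is uncoloured. Its
  neighbour in \<open>W\<close> and a neighbour of that vertex in \<open>W\<close> are two of the at most 12 square
  neighbours of \<open>x\<close>.
\<close>

lemma extend_along_growth:
  assumes "grows H U" "\<forall>h\<in>H. \<exists>k\<in>H. E h k" "U \<subseteq> V" "proper f (V - U)"
  shows "\<exists>g. proper g (V - H) \<and> (\<forall>x\<in>V - U. g x = f x)"
  using assms
proof (induction arbitrary: f rule: grows.induct)
  case base
  then show ?case by blast
next
  case (step W x y)
  obtain z where z: "z \<in> W" "E y z"
    using grows_no_isolated[OF step.hyps(1) step.prems(1)] step.hyps(3) by blast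
  have xV: "x \<in> V" using step.prems(2) by simp
  have "sq x y" "sq x z"
    using sq_edge[OF step.hyps(4)] sq_path[OF step.hyps(4) z(2)] step.hyps(2) z(1) by auto
  then have "sq_nbrs x \<inter> (V - insert x W) \<subseteq> sq_nbrs x - {y, z}" "{y, z} \<subseteq> sq_nbrs x"
    using z(1) step.hyps(3) by (auto simp: sq_nbrs_def)
  moreover have "y \<noteq> z" using z(2) E_irrefl by blast
  ultimately have "card (sq_nbrs x \<inter> (V - insert x W)) \<le> card (sq_nbrs x) - 2"
    by (metis card_2_iff card_Diff_subset card_mono finite.emptyI finite.insertI finite_Diff
        finite_sq_nbrs)
  then have "card (avail f (V - insert x W) x) > 0"
    using card_avail[OF xV, of f "V - insert x W"] card_sq_nbrs_le_12[of x] by linarith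
  then obtain c where c: "c \<in> avail f (V - insert x W) x"
    by (metis all_not_in_conv card.empty less_nat_zero_code)
  have "proper (f(x := c)) (insert x (V - insert x W))"
    using proper_fun_upd[OF step.prems(3) _ c] by blast
  also have "insert x (V - insert x W) = V - W"
    using xV step.hyps(2) by blast
  finally obtain g where "proper g (V - H)" "\<forall>z\<in>V - W. g z = (f(x := c)) z"
    using step.IH step.prems(1,2) by blast
  then show ?case
    by (intro exI[of _ g]) auto
qed

end

section \<open>Uncolourable squares and reducible kernels\<close>

locale counterexample = list_assignment +
  assumes not_colourable: "\<not> proper f V"
begin

lemma uncolourable_kernel:
  assumes "H \<subseteq> V" "H \<noteq> {}" "\<forall>h\<in>H. \<exists>k\<in>H. E h k"
  obtains f where "proper f (V - H)"
proof -
  have "proper f (V - V)" for f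
    unfolding proper_def by simp
  then show thesis
    using extend_along_growth[OF grows_V[OF assms(1,2)] assms(3)] that by blast
qed

text \<open>
  Otherwise \<open>u\<close> and \<open>v\<close> can be coloured last, in this order: 11 colours suffice against the 10
  square neighbours of \<open>u\<close> other than \<open>v\<close> and then against those of \<open>v\<close>.
\<close>

lemma no_deficient_edge:
  assumes "E u v" "card (sq_nbrs u) \<le> 11" "card (sq_nbrs v) \<le> 10"
  shows False
proof -
  have uv: "u \<in> V" "v \<in> V" "u \<noteq> v" "v \<in> sq_nbrs u"
    using assms(1) E_V E_V2 E_irrefl sq_edge by (auto simp: sq_nbrs_def)
  obtain f where f: "proper f (V - {u, v})"
    using uncolourable_kernel[of "{u, v}"] uv assms(1) E_sym by blast
  have "card (sq_nbrs u \<inter> (V - {u, v})) \<le> card (sq_nbrs u - {v})"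
    by (intro card_mono) auto
  also have "\<dots> \<le> 10"
    using assms(2) uv(4) by simp
  finally have "card (avail f (V - {u, v}) u) > 0"
    using card_avail[OF uv(1), of f "V - {u, v}"] by linarith
  then obtain c where c: "c \<in> avail f (V - {u, v}) u"
    by (metis all_not_in_conv card.empty less_nat_zero_code)
  have f': "proper (f(u := c)) (insert u (V - {u, v}))"
    using proper_fun_upd[OF f _ c] by blast
  have "card (sq_nbrs v \<inter> insert u (V - {u, v})) \<le> card (sq_nbrs v)"
    by (intro card_mono) auto
  then have "card (avail (f(u := c)) (insert u (V - {u, v})) v) > 0"
    using card_avail[OF uv(2), of "f(u := c)" "insert u (V - {u, v})"] assms(3) by linarith
  then obtain d where d: "d \<in> avail (f(u := c)) (insert u (V - {u, v})) v"
    by (metis all_not_in_conv card.empty less_nat_zero_code)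
  have "proper (f(u := c, v := d)) (insert v (insert u (V - {u, v})))"
    using proper_fun_upd[OF f' _ d] uv(3) by blast
  also have "insert v (insert u (V - {u, v})) = V"
    using uv by blast
  finally show False using not_colourable by blast
qed

text \<open>
  The kernel consists of \<open>u\<close>, \<open>v\<close> and a set \<open>W\<close> of common square neighbours. Once everything else
  is coloured, \<open>W\<close> can be coloured greedily from any start, as \<open>u\<close> and \<open>v\<close> come later, and \<open>u\<close> and
  \<open>v\<close> still have \<open>card W + 1\<close> colours each. That suffices for \<open>u\<close>, which is coloured before \<open>v\<close>,
  but \<open>v\<close> lacks one colour. It is gained in the independent set \<open>I\<close>. A vertex \<open>x\<close> of \<open>I\<close> still has
  at least \<open>room x\<close> colours. If two vertices of \<open>I\<close> have a colour in common, both receive it.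
  Otherwise the vertices of \<open>I\<close> have at least \<open>card W + 2\<close> colours together, and one of them can
  receive a colour that does not matter to \<open>v\<close>.
\<close>

lemma no_reducible_kernel:
  assumes uv: "u \<in> V" "v \<in> V" "sq u v"
    and d2: "card (sq_nbrs u) \<le> 11" "card (sq_nbrs v) \<le> 11"
    and W: "\<And>x. x \<in> W \<Longrightarrow> sq u x \<and> sq v x"
    and no_isolated: "\<forall>h\<in>insert u (insert v W). \<exists>k\<in>insert u (insert v W). E h k"
    and I: "I \<subseteq> W" "\<And>x y. x \<in> I \<Longrightarrow> y \<in> I \<Longrightarrow> \<not> sq x y"
    and room: "\<And>x. x \<in> I \<Longrightarrow> room x + card (sq_nbrs x) \<le> 13 + card (sq_nbrs x \<inter> W)"
    and sum: "card W + 2 \<le> (\<Sum>x\<in>I. room x)"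
  shows False
proof -
  define H where "H = insert u (insert v W)"
  define D where "D = V - H"
  have WV: "W \<subseteq> V"
    using W sq_nbrs_subset[of u] by (auto simp: sq_nbrs_def)
  have fin: "finite W" "finite I"
    using finite_subset[OF WV finite_V] finite_subset[OF I(1)] by simp_all
  have irrefl: "\<not> sq x x" for x
    unfolding sq_def by simp
  have ne: "u \<noteq> v" "u \<notin> W" "v \<notin> W"
    using uv(3) W irrefl by blast+
  have HV: "H \<subseteq> V"
    unfolding H_def using uv WV by blast
  obtain f where f: "proper f D"
    unfolding D_def
    by (rule uncolourable_kernel[of H]) (use HV no_isolated in \<open>auto simp: H_def\<close>)
  define A where "A = avail f D"
  have card_A: "card (sq_nbrs x \<inter> H) + 11 \<le> card (A x) + card (sq_nbrs x)" if "x \<in> V" for x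
  proof -
    have "card (sq_nbrs x) = card (sq_nbrs x \<inter> H) + card (sq_nbrs x \<inter> D)"
      unfolding D_def using sq_nbrs_subset[of x]
      by (subst card_Un_disjoint[symmetric]) (auto intro: arg_cong[where f = card])
    then show ?thesis
      using card_avail[OF that, of f D] unfolding A_def by linarith
  qed
  have card_A_I: "room x \<le> card (A x)" if "x \<in> I" for x
  proof -
    have "x \<in> W" using that I(1) by blast
    then have "sq_nbrs x \<inter> H = insert u (insert v (sq_nbrs x \<inter> W))"
      unfolding H_def using W sq_sym by (auto simp: sq_nbrs_def)
    then have "card (sq_nbrs x \<inter> H) = card (sq_nbrs x \<inter> W) + 2"
      using ne fin by simp
    then show ?thesis
      using card_A[of x] room[OF that] \<open>x \<in> W\<close> WV by fastforce
  qed
  have "sq_nbrs v \<inter> H = insert u W"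
    unfolding H_def using W uv(3) sq_sym irrefl by (auto simp: sq_nbrs_def)
  then have "card W + 1 \<le> card (A v)"
    using card_A[OF uv(2)] d2(2) ne fin by simp
  \<comment> \<open>Cutting the colours of \<open>v\<close> down to exactly \<open>card W + 1\<close> makes the lists of \<open>I\<close> exceed them.\<close>
  then obtain B where B: "B \<subseteq> A v" "card B = card W + 1"
    using obtain_subset_with_card_n by metis
  have finB: "finite B"
    using B(2) card.infinite by fastforce
  have complete: "\<exists>g. proper g (D \<union> W) \<and> (\<forall>x\<in>D \<union> J. g x = f' x)"
    if J: "J \<subseteq> W" and f': "proper f' (D \<union> J)" for J f'
  proof -
    have "\<exists>g. proper g ((D \<union> J) \<union> (W - J)) \<and> (\<forall>x\<in>D \<union> J. g x = f' x)"
    proof (rule extend_if_few_coloured)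
      fix x assume "x \<in> W - J"
      then have "sq_nbrs x \<inter> (D \<union> J \<union> (W - J)) \<subseteq> sq_nbrs x - {u, v}" "{u, v} \<subseteq> sq_nbrs x"
        using W sq_sym ne J unfolding D_def H_def sq_nbrs_def by auto
      then have "card (sq_nbrs x \<inter> (D \<union> J \<union> (W - J))) \<le> card (sq_nbrs x) - card {u, v}"
        by (metis card_Diff_subset card_mono finite.emptyI finite.insertI finite_Diff finite_sq_nbrs)
      then show "card (sq_nbrs x \<inter> (D \<union> J \<union> (W - J))) \<le> 10"
        using card_sq_nbrs_le_12[of x] ne by simp
    qed (use fin WV f' in \<open>auto simp: D_def H_def\<close>)
    moreover have "D \<union> J \<union> (W - J) = D \<union> W" using J by blast
    ultimately show ?thesis by simp
  qed
  have DI: "x \<notin> D" if "x \<in> I" for x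
    using that I(1) unfolding D_def H_def by blast
  have "\<exists>g. proper g (D \<union> W) \<and> (\<forall>x\<in>D. g x = f x) \<and> card (g ` W \<inter> B) + 1 \<le> card W"
  proof (cases "\<exists>x\<in>I. \<exists>y\<in>I. x \<noteq> y \<and> A x \<inter> A y \<noteq> {}")
    case True
    then obtain x y c where xy: "x \<in> I" "y \<in> I" "x \<noteq> y" and c: "c \<in> A x" "c \<in> A y"
      by blast
    have "proper (f(x := c)) (insert x D)"
      using proper_fun_upd[OF f DI[OF xy(1)]] c(1) unfolding A_def by blast
    moreover have "c \<in> avail (f(x := c)) (insert x D) y"
      using c(2) I(2)[OF xy(2,1)] DI[OF xy(1)] unfolding A_def avail_def sq_nbrs_def by auto
    ultimately have "proper (f(x := c, y := c)) (insert y (insert x D))"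
      using proper_fun_upd[of "f(x := c)" "insert x D" y c] DI[OF xy(2)] xy(3) by simp
    moreover have "insert y (insert x D) = D \<union> {x, y}" by blast
    ultimately obtain g where g: "proper g (D \<union> W)"
      "\<forall>z\<in>D \<union> {x, y}. g z = (f(x := c, y := c)) z"
      using complete[of "{x, y}" "f(x := c, y := c)"] xy I(1) by auto
    have "g x = g y" using g(2) by simp
    then have "g ` W = g ` (W - {y})"
      using xy I(1) by (smt (verit, best) Diff_iff image_cong image_insert insert_Diff insert_absorb
          image_eqI singletonD subsetD)
    then have "card (g ` W) \<le> card (W - {y})"
      using fin card_image_le[of "W - {y}" g] by simp
    moreover have "card (g ` W \<inter> B) \<le> card (g ` W)"
      using fin by (intro card_mono) auto
    moreover have "card (W - {y}) + 1 = card W"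
      using xy I(1) fin card_Suc_Diff1[of W y] by auto
    moreover have "\<forall>z\<in>D. g z = f z"
      using g(2) DI xy by auto
    ultimately show ?thesis using g(1) by (intro exI[of _ g]) auto
  next
    case False
    have finA: "finite (A x)" if "x \<in> I" for x
      using finite_L[of x] that I(1) WV unfolding A_def avail_def by auto
    have "card (\<Union>x\<in>I. A x) = (\<Sum>x\<in>I. card (A x))"
      using False finA fin by (intro card_UN_disjoint) auto
    also have "\<dots> \<ge> (\<Sum>x\<in>I. room x)"
      by (intro sum_mono card_A_I)
    finally have "card B < card (\<Union>x\<in>I. A x)"
      using sum B(2) by linarith
    then have "\<not> (\<Union>x\<in>I. A x) \<subseteq> B"
      using finB card_mono linorder_not_less by blast
    then obtain x c where x: "x \<in> I" "c \<in> A x" "c \<notin> B" by blast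
    have "proper (f(x := c)) (D \<union> {x})"
      using proper_fun_upd[OF f DI[OF x(1)]] x(2) unfolding A_def by simp
    then obtain g where g: "proper g (D \<union> W)" "\<forall>z\<in>D \<union> {x}. g z = (f(x := c)) z"
      using complete[of "{x}" "f(x := c)"] x(1) I(1) by auto
    have "g ` W \<inter> B \<subseteq> g ` (W - {x})"
      using g(2) x(3) by auto
    then have "card (g ` W \<inter> B) \<le> card (W - {x})"
      using fin card_image_le[of "W - {x}" g] card_mono[of "g ` (W - {x})" "g ` W \<inter> B"] by simp
    moreover have "card (W - {x}) + 1 = card W"
      using x I(1) fin card_Suc_Diff1[of W x] by auto
    moreover have "\<forall>z\<in>D. g z = f z"
      using g(2) DI x(1) by auto
    ultimately show ?thesis using g(1) by (intro exI[of _ g]) auto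
  qed
  then obtain g where g: "proper g (D \<union> W)" "\<forall>x\<in>D. g x = f x"
    and gB: "card (g ` W \<inter> B) + 1 \<le> card W"
    by blast
  have uv_out: "u \<notin> D \<union> W" "v \<notin> insert u (D \<union> W)"
    using ne unfolding D_def H_def by auto
  have "card (sq_nbrs u \<inter> (D \<union> W)) \<le> card (sq_nbrs u - {v})"
    using uv_out by (intro card_mono) auto
  also have "\<dots> \<le> 10"
    using d2(1) uv(3) by (simp add: sq_nbrs_def[of u])
  finally have "card (avail g (D \<union> W) u) > 0"
    using card_avail[OF uv(1), of g "D \<union> W"] by linarith
  then obtain c where c: "c \<in> avail g (D \<union> W) u"
    by (metis all_not_in_conv card.empty less_nat_zero_code)
  have gu: "proper (g(u := c)) (insert u (D \<union> W))"
    using proper_fun_upd[OF g(1) uv_out(1) c] .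
  have "card (insert c (g ` W \<inter> B)) < card B"
    using gB B(2) card_insert_le_m1[of "card W" "g ` W \<inter> B" c] by linarith
  then have "\<not> B \<subseteq> insert c (g ` W \<inter> B)"
    using fin card_mono[of "insert c (g ` W \<inter> B)" B] by force
  then obtain d where d: "d \<in> B" "d \<noteq> c" "d \<notin> g ` W" by blast
  have "d \<in> avail (g(u := c)) (insert u (D \<union> W)) v"
    using d B(1) g(2) uv_out(1) unfolding A_def avail_def by auto
  from proper_fun_upd[OF gu uv_out(2) this]
  have "proper (g(u := c, v := d)) (insert v (insert u (D \<union> W)))" .
  also have "insert v (insert u (D \<union> W)) = V"
    using HV unfolding D_def H_def by blast
  finally show False using not_colourable by blast
qed

section \<open>Degrees and short cycles\<close>

lemma ex_nbr:
  assumes "x \<in> V"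
  shows "\<exists>y. E x y"
proof (cases "V = {x}")
  case True
  obtain c where "c \<in> L x"
    using card_L[OF assms] by fastforce
  then have "proper (\<lambda>_. c) V"
    using True unfolding proper_def sq_def by simp
  then show ?thesis using not_colourable by blast
next
  case False
  then show ?thesis
    using connected[of "{x}"] assms E_sym by blast
qed

text \<open>
  A vertex of degree at most 2 has square degree at most \<open>2 \<cdot> 4\<close>, and it lowers the square degree
  of its neighbours below 12.
\<close>

lemma deg_ge_3:
  assumes "v \<in> V"
  shows "deg v \<ge> 3"
proof (rule ccontr)
  assume "\<not> deg v \<ge> 3"
  then have v: "deg v \<le> 2" by simp
  obtain u where u: "E v u" using ex_nbr assms by blast
  have "card (sq_nbrs v) \<le> (\<Sum>y\<in>nbrs v. deg y)"
    using card_sq_nbrs_coincidences[of "{}" v] by simp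
  then have "card (sq_nbrs v) \<le> 10"
    using sum_deg_nbrs_le[of "{}" v] v by simp
  moreover have "card (sq_nbrs u) \<le> 11"
  proof -
    have vu: "v \<in> nbrs u" using u E_sym by (simp add: nbrs_def)
    have le: "card (sq_nbrs u) \<le> deg v + (\<Sum>y\<in>nbrs u - {v}. deg y)"
      using card_sq_nbrs_coincidences[of "{}" u] vu by (simp add: sum.remove)
    show ?thesis
    proof (cases "deg u = 4")
      case True
      then have "(\<Sum>y\<in>nbrs u - {v}. deg y) \<le> card (nbrs u - {v}) * 3"
        using sum_bounded_above[of "nbrs u - {v}" deg 3] deg_le_3_if_edge by (auto simp: nbrs_def)
      then show ?thesis using le v True vu by simp
    next
      case False
      have "(\<Sum>y\<in>nbrs u - {v}. deg y) \<le> card (nbrs u - {v}) * 4"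
        using sum_bounded_above[of "nbrs u - {v}" deg 4] deg_le_4 by simp
      moreover have "card (nbrs u - {v}) \<le> 2"
        using False deg_le_4[of u] vu by simp
      ultimately show ?thesis using le v by linarith
    qed
  qed
  ultimately show False
    using no_deficient_edge E_sym u by blast
qed

lemma deg_cases:
  assumes "v \<in> V"
  shows "deg v = 3 \<or> deg v = 4"
  using deg_ge_3[OF assms] deg_le_4[of v] by linarith

lemma deg_3_if_edge: "E u v \<Longrightarrow> deg u = 4 \<Longrightarrow> deg v = 3"
  using deg_cases E_V2 deg_4_independent by blast

text \<open>
  With two neighbours of degree 3, a vertex of degree 3 has square degree at most 10, and these
  neighbours have square degree at most 11.
\<close>

lemma deg_4_if_two_nbrs:
  assumes "deg v = 3" "E v u" "E v w" "u \<noteq> w" "deg u = 3"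
  shows "deg w = 4"
proof (rule ccontr)
  assume "deg w \<noteq> 4"
  then have "deg w = 3" using deg_cases E_V2 assms(3) by blast
  then show False
    using no_deficient_edge[of u v] card_sq_nbrs_le_11[of v u] card_sq_nbrs_le_10[of u v w]
      assms E_sym by fastforce
qed

lemma third_nbr:
  assumes "deg v = 3" "E v u" "E v w" "u \<noteq> w"
  obtains x where "nbrs v = {u, w, x}" "x \<noteq> u" "x \<noteq> w" "E v x"
proof -
  have "card (nbrs v - {u, w}) = 1"
    using assms by (subst card_Diff_subset) (auto simp: nbrs_def)
  then obtain x where "nbrs v - {u, w} = {x}"
    by (auto simp: card_1_singleton_iff)
  then show thesis
    using assms that[of x] by (auto simp: nbrs_def)
qed

text \<open>
  At least two of the vertices have degree 3. For each of them the other one and the triangle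
  lower the square degree to at most 10.
\<close>

lemma no_triangle:
  assumes "E x y" "E y z" "E z x"
  shows False
proof -
  have *: False if "E x y" "E y z" "E z x" "deg x = 3" "deg y = 3" for x y z
  proof -
    have "card (sq_nbrs x) + card {(y, z)} + card {y} \<le> 12"
      by (rule card_sq_nbrs_le(2)[OF coincidence_triangle[of x y z]])
        (use that in \<open>auto simp: nbrs_def\<close>)
    then show False
      using no_deficient_edge[of y x] card_sq_nbrs_le_11[of x y] that E_sym by force
  qed
  have "deg x = 3 \<or> deg x = 4" "deg y = 3 \<or> deg y = 4" "deg z = 3 \<or> deg z = 4"
    using deg_cases E_V assms by blast+
  then show False
    using *[of x y z] *[of y z x] *[of z x y] deg_3_if_edge assms E_sym by metis
qed

text \<open>
  A 4-cycle lowers the square degrees of its vertices by one, an edge between two vertices of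
  degree 3 those of its ends by another one. So degrees 4 and 3 alternate along the cycle, which
  is \<open>a, b, a', b'\<close> with \<open>deg a = 4\<close>, and the third neighbour \<open>r\<close> of \<open>b\<close> has degree 4. Then \<open>r\<close>
  and \<open>b'\<close> are not adjacent in the square, and the colour that is missing at \<open>a, b\<close> is gained from
  them.
\<close>

lemma no_4_cycle:
  assumes "E x y" "E y z" "E z w" "E w x" "x \<noteq> z" "y \<noteq> w"
  shows False
proof -
  have le_11: "card (sq_nbrs x) \<le> 11"
    if "E x y" "E y z" "E z w" "E w x" "x \<noteq> z" "y \<noteq> w" for x y z w
    using card_sq_nbrs_le(1)[OF coincidence_4_cycle[OF that]] by simp
  have le_10: "card (sq_nbrs x) \<le> 10"
    if "E x y" "E y z" "E z w" "E w x" "x \<noteq> z" "y \<noteq> w" "E x r" "deg x = 3" "deg r = 3"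
    for x y z w r
  proof -
    have "card (sq_nbrs x) + card {(y, z)} + card {r} \<le> 12"
      by (rule card_sq_nbrs_le(2)[OF coincidence_4_cycle[OF that(1-6)]])
        (use that in \<open>auto simp: nbrs_def\<close>)
    then show ?thesis by simp
  qed
  have no_BB: False
    if "E x y" "E y z" "E z w" "E w x" "x \<noteq> z" "y \<noteq> w" "E x r" "deg x = 3" "deg r = 3"
    for x y z w r
    using no_deficient_edge[of y x] le_10[OF that] le_11[of y z w x] that E_sym[of x y] by fastforce
  have alternating: False
    if cycle: "E a b" "E b a'" "E a' b'" "E b' a" "a \<noteq> a'" "b \<noteq> b'" and a: "deg a = 4" for a b a' b'
  proof -
    have sym: "E b a" "E a' b" "E b' a'" "E a b'"
      using cycle E_sym by blast+
    have b: "deg b = 3" "deg b' = 3"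
      using deg_3_if_edge a cycle(1) sym(4) by blast+
    obtain r where r: "r \<noteq> a" "r \<noteq> a'" "E b r"
      using third_nbr[OF b(1) sym(1) cycle(2,5)] by metis
    have "deg r \<noteq> 3"
      using no_BB[of b a' b' a r] cycle sym b r by blast
    then have r4: "deg r = 4" using deg_cases E_V2 r(3) by blast
    have rb': "\<not> E r b'" if "sq r b'"
    proof
      assume "E r b'"
      \<comment> \<open>Now \<open>b'\<close> is the endpoint of three walks from \<open>b\<close>.\<close>
      then have walks: "(r, b') \<in> walks b - {(a, b'), (a', b')}" "{(a, b'), (a', b')} \<subseteq> walks b"
        using cycle sym r unfolding walks_def nbrs_def by auto
      have "\<exists>q\<in>walks b - {(a, b'), (a', b')}. endpoint b q = endpoint b p"
        if "p \<in> {(a, b'), (a', b')}" for p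
        using that cycle(6) by (intro bexI[OF _ walks(1)]) (auto simp: endpoint_def)
      from card_sq_nbrs_le(1)[OF walks(2) this]
      have "card (sq_nbrs b) + card {(a, b'), (a', b')} \<le> 12" .
      then have "card (sq_nbrs b) \<le> 10"
        using cycle(5) by simp
      then show False
        using no_deficient_edge[of a b] le_11[OF cycle] cycle(1) by blast
    qed
    have not_sq: "\<not> sq r b'"
    proof
      assume s: "sq r b'"
      then obtain m where m: "E r m" "E m b'"
        using rb' unfolding sq_def by blast
      have m3: "deg m = 3" using deg_3_if_edge r4 m(1) by blast
      show False
        using no_BB[of b' a' b a m] cycle sym b m m3 E_sym by blast
    qed
    have ne: "r \<noteq> b'"
      using no_triangle[of a b b'] r(3) cycle sym by blast
    \<comment> \<open>Both have the square neighbour \<open>a'\<close> in \<open>{a', b', r}\<close>; \<open>b'\<close> has one more colour as it lies on the cycle.\<close>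
    define room where "room = (\<lambda>x. if x = r then 2 else 3 :: nat)"
    show False
    proof (rule no_reducible_kernel[of a b "{a', b', r}" "{r, b'}" room])
      show "sq a b" using sq_edge cycle by blast
      show "card (sq_nbrs a) \<le> 11" using le_11[OF cycle] .
      show "card (sq_nbrs b) \<le> 11" using le_11[of b a' b' a] cycle sym by blast
      show "sq a x \<and> sq b x" if "x \<in> {a', b', r}" for x
        using that sq_edge[OF sym(4)] sq_edge[OF cycle(2)] sq_edge[OF r(3)] sq_path[OF cycle(1,2,5)]
          sq_path[OF cycle(1) r(3)] sq_path[OF sym(1,4) cycle(6)] r(1) by auto
      show "\<forall>h\<in>insert a (insert b {a', b', r}). \<exists>k\<in>insert a (insert b {a', b', r}). E h k"
        using cycle sym r E_sym by blast
      show "\<not> sq x y" if "x \<in> {r, b'}" "y \<in> {r, b'}" for x y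
        using that not_sq sq_sym[of b' r] sq_def[of x x] by auto
      show "room x + card (sq_nbrs x) \<le> 13 + card (sq_nbrs x \<inter> {a', b', r})" if "x \<in> {r, b'}" for x
      proof -
        have "sq x a'"
          using that sq_edge[OF sym(3)] sq_path[OF E_sym[OF r(3)] cycle(2) r(2)] by auto
        then have "card {a'} \<le> card (sq_nbrs x \<inter> {a', b', r})"
          by (intro card_mono) (auto simp: sq_nbrs_def)
        moreover have "card (sq_nbrs b') \<le> 11"
          using le_11[of b' a b a'] cycle sym by blast
        ultimately show ?thesis
          using that card_sq_nbrs_le_12[of x] unfolding room_def by auto
      qed
      have "card {a', b', r} = 3"
        using r(2) ne cycle(3) E_irrefl[of a'] by (auto simp: card_insert_if)
      then show "card {a', b', r} + 2 \<le> (\<Sum>x\<in>{r, b'}. room x)"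
        using ne unfolding room_def by simp
    qed (use E_V[OF cycle(1)] E_V2[OF cycle(1)] in auto)
  qed
  have "deg x = 3 \<or> deg x = 4" "deg y = 3 \<or> deg y = 4"
    using deg_cases E_V assms by blast+
  then show False
    using alternating[OF assms] alternating[of y z w x] no_BB[OF assms assms(1)] assms by blast
qed

text \<open>
  The adjacent vertices \<open>v, v'\<close> of degree 3 have square degree at most 11. If also the opposite
  vertex \<open>z\<close> of the cycle has a neighbour of degree 3, then \<open>v\<close> and \<open>z\<close> are coloured last and the
  missing colour is gained from \<open>v'\<close> and a neighbour \<open>e\<close> of \<open>x\<close> outside the cycle. Otherwise \<open>v\<close>
  and \<open>v'\<close> are coloured last. Their remaining neighbours \<open>x'\<close> and \<open>y'\<close> have degree 4, as all
  neighbours of \<open>z\<close> do, so neither has a common neighbour with \<open>z\<close>. It depends on the square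
  adjacencies between \<open>x, x'\<close> and \<open>y, y'\<close> which independent subset of \<open>{x, x', y, y', z}\<close> has
  enough colours.
\<close>

lemma no_5_cycle_at_deg_3_edge:
  assumes v: "deg v = 3" "deg v' = 3"
    and cycle: "E v v'" "E v' y" "E y z" "E z x" "E x v"
  shows False
proof -
  have sym: "E v' v" "E y v'" "E z y" "E x z" "E v x"
    using cycle E_sym by blast+
  note tri = no_triangle and quad = no_4_cycle
  have ne1: "y \<noteq> v" "x \<noteq> v'"
    using tri[of z x v] tri[of v' y z] cycle by auto
  have deg_xy: "deg x = 4" "deg y = 4"
    using deg_4_if_two_nbrs[OF v(1) cycle(1) sym(5) _ v(2)]
      deg_4_if_two_nbrs[OF v(2) sym(1) cycle(2) _ v(1)] ne1 by auto
  have z: "deg z = 3"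
    using deg_3_if_edge[OF cycle(3) deg_xy(2)] .
  obtain x' where nbrs_v: "nbrs v = {v', x, x'}" and x': "x' \<noteq> v'" "x' \<noteq> x" "E v x'"
    using third_nbr[OF v(1) cycle(1) sym(5) ne1(2)[symmetric]] by metis
  obtain y' where nbrs_v': "nbrs v' = {v, y, y'}" and y': "y' \<noteq> v" "y' \<noteq> y" "E v' y'"
    using third_nbr[OF v(2) sym(1) cycle(2) ne1(1)[symmetric]] by metis
  have E_v: "w = v' \<or> w = x \<or> w = x'" if "E v w" for w
    using that nbrs_v unfolding nbrs_def by blast
  have E_v': "w = v \<or> w = y \<or> w = y'" if "E v' w" for w
    using that nbrs_v' unfolding nbrs_def by blast
  have deg_xy': "deg x' = 4" "deg y' = 4"
    using deg_4_if_two_nbrs[OF v(1) cycle(1) x'(3) _ v(2)]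
      deg_4_if_two_nbrs[OF v(2) sym(1) y'(3) _ v(1)] x'(1) y'(1) by auto
  have not_E4: "\<not> E a b" if "deg a = 4" "deg b = 4" for a b
    using that deg_3_if_edge by fastforce
  have ne2: "x \<noteq> y" "x \<noteq> y'" "x' \<noteq> y" "x' \<noteq> y'" "z \<noteq> v" "z \<noteq> v'"
    "z \<noteq> x" "z \<noteq> x'" "z \<noteq> y" "z \<noteq> y'" "v \<noteq> v'"
    using tri[of v v' x] tri[of v v' x'] cycle sym x' y' E_sym v z deg_xy deg_xy' E_irrefl
      tri[of v' y v] tri[of v x v'] by (auto; fail)+
  have d2: "card (sq_nbrs v) \<le> 11" "card (sq_nbrs v') \<le> 11"
    using card_sq_nbrs_le_11 v cycle(1) sym(1) by simp_all
  have V: "v \<in> V" "v' \<in> V" "z \<in> V"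
    using cycle E_V by blast+
  show False
  proof (cases "\<exists>r. E z r \<and> deg r = 3")
    case True
    then have d2z: "card (sq_nbrs z) \<le> 11"
      using card_sq_nbrs_le_11 z E_sym by fastforce
    have "card (nbrs x - {v, z}) = 2"
      using deg_xy(1) cycle(5) sym(4) ne2(5) by (subst card_Diff_subset) (auto simp: nbrs_def)
    then obtain e1 e2 where e12: "nbrs x - {v, z} = {e1, e2}" "e1 \<noteq> e2"
      by (auto simp: card_2_iff)
    \<comment> \<open>If \<open>e\<close> were adjacent to \<open>y'\<close>, it would be a square neighbour of \<open>v'\<close>.\<close>
    have "\<not> E e1 y' \<or> \<not> E e2 y'"
      using quad[of x e1 y' e2] e12 ne2(2) E_sym unfolding nbrs_def by blast
    then obtain e where e: "E x e" "e \<noteq> v" "e \<noteq> z" "\<not> E e y'"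
      using e12 unfolding nbrs_def by blast
    have ex: "E e x" using e(1) E_sym by blast
    have deg_e: "deg e = 3" using deg_3_if_edge[OF e(1) deg_xy(1)] .
    have ne3: "e \<noteq> v'" "e \<noteq> x"
      using tri[of v v' x] cycle sym e E_irrefl E_sym by blast+
    have not_sq: "\<not> sq e v'"
    proof
      assume "sq e v'"
      then consider "E v' e" | m where "E v' m" "E e m"
        unfolding sq_def using E_sym by blast
      then show False
      proof cases
        case 1
        then show False
          using E_v'[of e] e(2) deg_e deg_xy deg_xy' by auto
      next
        case 2
        then show False
          using E_v'[of m] tri[of x e v] quad[of x e y z] e ex cycle sym ne2(1) E_sym by blast
      qed
    qed
    \<comment> \<open>Both have the square neighbour \<open>x\<close> in \<open>{e, v', x}\<close>; \<open>v'\<close> has one more colour as its square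
      degree is at most 11.\<close>
    define room where "room = (\<lambda>w. if w = e then 2 else 3 :: nat)"
    have sqs: "sq v z" "sq v e" "sq v v'" "sq v x" "sq z e" "sq z v'" "sq z x" "sq e x" "sq v' x"
      using sq_path[OF sym(5,4)] sq_path[OF sym(5) e(1)] sq_edge[OF cycle(1)] sq_edge[OF sym(5)]
        sq_path[OF cycle(4) e(1)] sq_path[OF sym(3,2)] sq_edge[OF cycle(4)] sq_edge[OF ex]
        sq_path[OF sym(1,5)] ne1 ne2 e by auto
    show False
    proof (rule no_reducible_kernel[of v z "{e, v', x}" "{e, v'}" room])
      show "sq v w \<and> sq z w" if "w \<in> {e, v', x}" for w
        using that sqs by auto
      show "\<forall>h\<in>insert v (insert z {e, v', x}). \<exists>k\<in>insert v (insert z {e, v', x}). E h k"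
        using cycle sym ex by blast
      show "\<not> sq a b" if "a \<in> {e, v'}" "b \<in> {e, v'}" for a b
        using that not_sq sq_sym[of v' e] sq_def[of a a] by auto
      show "room w + card (sq_nbrs w) \<le> 13 + card (sq_nbrs w \<inter> {e, v', x})" if "w \<in> {e, v'}" for w
      proof -
        have "sq w x" using that sqs by auto
        then have "card {x} \<le> card (sq_nbrs w \<inter> {e, v', x})"
          by (intro card_mono) (auto simp: sq_nbrs_def)
        then show ?thesis
          using that card_sq_nbrs_le_12[of w] d2(2) unfolding room_def by auto
      qed
      have "card {e, v', x} = 3"
        using ne1 ne3 by (auto simp: card_insert_if)
      then show "card {e, v', x} + 2 \<le> (\<Sum>w\<in>{e, v'}. room w)"
        using ne3 unfolding room_def by simp
    qed (use V sqs d2 d2z in auto)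
  next
    case False
    then have z_nbrs: "deg r = 4" if "E z r" for r
      using that deg_cases E_V2 by blast
    have far: "\<not> sq z x'" "\<not> sq z y'"
    proof -
      have "\<not> E z x'"
        using quad[of v x z x'] cycle sym x' E_sym ne2 by blast
      then show "\<not> sq z x'"
        unfolding sq_def using z_nbrs not_E4 deg_xy' by blast
      have "\<not> E z y'"
        using quad[of v' y z y'] cycle sym y' E_sym ne2 by blast
      then show "\<not> sq z y'"
        unfolding sq_def using z_nbrs not_E4 deg_xy' by blast
    qed
    define W where "W = {x, x', y, y', z}"
    have card_W: "card W = 5"
      unfolding W_def using x'(2) y'(2) ne2 by (auto simp: card_insert_if)
    have ex': "E x' v" and ey': "E y' v'"
      using x' y' E_sym by blast+
    have sqs: "sq v v'" "sq v x" "sq v x'" "sq v y" "sq v y'" "sq v z"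
      "sq v' x" "sq v' x'" "sq v' y" "sq v' y'" "sq v' z"
      "sq x x'" "sq y y'" "sq x y" "sq z x" "sq z y"
      using sq_edge[OF cycle(1)] sq_edge[OF sym(5)] sq_edge[OF x'(3)] sq_path[OF cycle(1,2)]
        sq_path[OF cycle(1) y'(3)] sq_path[OF sym(5,4)] sq_path[OF sym(1,5)]
        sq_path[OF sym(1) x'(3)] sq_edge[OF cycle(2)] sq_edge[OF y'(3)] sq_path[OF cycle(2,3)]
        sq_path[OF cycle(5) x'(3)] sq_path[OF sym(2) y'(3)] sq_path[OF sym(4,3)]
        sq_edge[OF cycle(4)] sq_edge[OF sym(3)] ne1 ne2 x' y' by auto
    \<comment> \<open>\<open>M w\<close> is a set of known square neighbours of \<open>w\<close> in \<open>W\<close>.\<close>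
    have kernel: False
      if I: "I \<subseteq> W" "\<And>a b. a \<in> I \<Longrightarrow> b \<in> I \<Longrightarrow> \<not> sq a b"
        and M: "\<And>w. w \<in> I \<Longrightarrow> M w \<subseteq> W \<and> (\<forall>m\<in>M w. sq w m)"
        and sum: "7 \<le> (\<Sum>w\<in>I. card (M w) + 1)" for I M
    proof (rule no_reducible_kernel[of v v' W I "\<lambda>w. card (M w) + 1"])
      show "sq v w \<and> sq v' w" if "w \<in> W" for w
        using that sqs unfolding W_def by auto
      show "\<forall>h\<in>insert v (insert v' W). \<exists>k\<in>insert v (insert v' W). E h k"
        unfolding W_def using cycle sym ex' ey' by blast
      show "card (M w) + 1 + card (sq_nbrs w) \<le> 13 + card (sq_nbrs w \<inter> W)" if "w \<in> I" for w
      proof -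
        have "card (M w) \<le> card (sq_nbrs w \<inter> W)"
          using M[OF that] by (intro card_mono) (simp, auto simp: sq_nbrs_def)
        then show ?thesis using card_sq_nbrs_le_12[of w] by linarith
      qed
      show "card W + 2 \<le> (\<Sum>w\<in>I. card (M w) + 1)"
        using sum card_W by linarith
    qed (use V sqs d2 I in auto)
    note sq_symD = sqs(12-16)[THEN sq_sym]
    have irrefl: "\<not> sq a a" for a
      unfolding sq_def by simp
    consider "\<not> sq x' y'" | "\<not> sq x y'" "sq x' y'" | "sq x y'" "sq x' y'"
      by blast
    then show False
    proof cases
      case 1
      define M where "M = (\<lambda>w. if w = z then {x, y} else if w = x' then {x} else {y})"
      show False
      proof (rule kernel[of "{z, x', y'}" M])
        show "\<not> sq a b" if "a \<in> {z, x', y'}" "b \<in> {z, x', y'}" for a b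
          using that 1 far irrefl sq_sym[of x' z] sq_sym[of y' z] sq_sym[of y' x'] by auto
        show "7 \<le> (\<Sum>w\<in>{z, x', y'}. card (M w) + 1)"
          using ne2 unfolding M_def by simp
      qed (use sqs sq_symD in \<open>auto simp: M_def W_def\<close>)
    next
      case 2
      define M where "M = (\<lambda>w. if w = x then {x', y, z} else {x', y})"
      show False
      proof (rule kernel[of "{x, y'}" M])
        show "\<not> sq a b" if "a \<in> {x, y'}" "b \<in> {x, y'}" for a b
          using that 2 irrefl sq_sym[of y' x] by auto
        show "7 \<le> (\<Sum>w\<in>{x, y'}. card (M w) + 1)"
          using ne2 unfolding M_def by simp
      qed (use sqs sq_symD 2 sq_sym[of x' y'] in \<open>auto simp: M_def W_def\<close>)
    next
      case 3
      define M where "M = (\<lambda>w. if w = z then {x, y} else {x, x', y})"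
      show False
      proof (rule kernel[of "{z, y'}" M])
        show "\<not> sq a b" if "a \<in> {z, y'}" "b \<in> {z, y'}" for a b
          using that far irrefl sq_sym[of y' z] by auto
        show "7 \<le> (\<Sum>w\<in>{z, y'}. card (M w) + 1)"
          using ne2 x'(2) unfolding M_def by simp
      qed (use sqs sq_symD 3 sq_sym[of x' y'] sq_sym[of x y'] in \<open>auto simp: M_def W_def\<close>)
    qed
  qed
qed

text \<open>Since 5 is odd, vertices of degree 4 and 3 cannot alternate around the cycle.\<close>

lemma no_5_cycle:
  assumes "E p q" "E q r" "E r s" "E s t" "E t p"
  shows False
proof -
  have "deg p = 3 \<or> deg p = 4" "deg q = 3 \<or> deg q = 4" "deg r = 3 \<or> deg r = 4"
    "deg s = 3 \<or> deg s = 4" "deg t = 3 \<or> deg t = 4"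
    using deg_cases E_V assms by blast+
  moreover have "\<not> (deg p = 4 \<and> deg q = 4)" "\<not> (deg q = 4 \<and> deg r = 4)"
    "\<not> (deg r = 4 \<and> deg s = 4)" "\<not> (deg s = 4 \<and> deg t = 4)" "\<not> (deg t = 4 \<and> deg p = 4)"
    using deg_4_independent assms by blast+
  ultimately consider "deg p = 3" "deg q = 3" | "deg q = 3" "deg r = 3" | "deg r = 3" "deg s = 3"
    | "deg s = 3" "deg t = 3" | "deg t = 3" "deg p = 3"
    by auto
  then show False
    using no_5_cycle_at_deg_3_edge assms by cases blast+
qed

section \<open>Graphs of girth at least six\<close>

text \<open>
  The vertices to be coloured first for an edge \<open>ab\<close>. The neighbour \<open>z\<close> of \<open>a\<close> is left out: it
  keeps the edge attached to the rest of the graph.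
\<close>

definition outer :: "'a \<Rightarrow> 'a \<Rightarrow> 'a \<Rightarrow> 'a set" where
  "outer a b z = (nbrs a - {b, z}) \<union> (nbrs b - {a})"

lemma ex_deg_4: "\<exists>a. a \<in> V \<and> deg a = 4"
proof -
  have "V \<noteq> {}"
    using not_colourable unfolding proper_def by auto
  then obtain v where v: "v \<in> V" by blast
  show ?thesis
  proof (cases "deg v = 4")
    case False
    then have d: "deg v = 3" using deg_cases v by blast
    then obtain u w where "u \<noteq> w" "E v u" "E v w"
      by (auto simp: card_3_iff nbrs_def)
    then show ?thesis
      using deg_4_if_two_nbrs[OF d] deg_cases E_V2 by blast
  qed (use v in blast)
qed

text \<open>Two such neighbours would close a cycle of length 4 or 5 through \<open>a\<close> or \<open>b\<close>.\<close>

lemma outer_nbr_unique: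
  assumes "E a b" "k \<noteq> a" "k \<noteq> b" "s \<in> outer a b z" "s' \<in> outer a b z" "E k s" "E k s'"
  shows "s = s'"
proof (rule ccontr)
  assume ne: "s \<noteq> s'"
  consider "E a s" "E a s'" | "E b s" "E b s'" | "E a s" "E b s'" | "E b s" "E a s'"
    using assms(4,5) unfolding outer_def nbrs_def by blast
  then show False
    using no_4_cycle[of k s a s'] no_4_cycle[of k s b s'] no_5_cycle[of k s a b s']
      no_5_cycle[of k s b a s'] assms ne E_sym
    by cases metis+
qed

text \<open>
  Take the configuration for which the region \<open>R\<close> grown from \<open>ab\<close> outside \<open>S = outer a b z\<close> is
  largest, and let \<open>K\<close> be the rest. There are no edges between \<open>K\<close> and \<open>R\<close>, so by connectedness
  some \<open>k\<close> in \<open>K\<close> is adjacent to some \<open>s\<close> in \<open>S\<close>, which is adjacent to \<open>a\<close> or \<open>b\<close>. Each vertex of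
  \<open>K\<close> has at most one neighbour in \<open>S\<close>, so at or next to \<open>k\<close> there is an edge \<open>a'b'\<close> inside \<open>K\<close>
  with \<open>deg a' = 4\<close>. It keeps its connection to \<open>R\<close> through \<open>s\<close> if \<open>z'\<close> is chosen on this path,
  because the absence of short cycles keeps the path clear of \<open>outer a' b' z'\<close>. Thus \<open>R\<close> and \<open>a'\<close>
  lie in the region of a new configuration, against the choice of \<open>R\<close>.
\<close>

lemma ex_connected_complement:
  "\<exists>a b z. deg a = 4 \<and> E a b \<and> E a z \<and> z \<noteq> b \<and> grows {a, b} (V - outer a b z)"
proof -
  define conf where "conf R a b z \<longleftrightarrow> deg a = 4 \<and> E a b \<and> E a z \<and> z \<noteq> b
    \<and> R \<subseteq> V - outer a b z \<and> grows {a, b} R" for R a b z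
  obtain a0 where a0: "a0 \<in> V" "deg a0 = 4" using ex_deg_4 by blast
  obtain b0 z0 where b0: "E a0 b0" "E a0 z0" "z0 \<noteq> b0"
  proof -
    have "1 < card (nbrs a0)" using a0(2) by simp
    then show thesis
      using that card_le_Suc0_iff_eq[OF finite_nbrs[of a0]] by (auto simp: nbrs_def)
  qed
  have "conf {a0, b0} a0 b0 z0"
    unfolding conf_def outer_def nbrs_def
    using a0 b0 E_irrefl E_V2 grows.base by (auto simp: nbrs_def)
  then have "\<exists>R. (\<exists>a b z. conf R a b z) \<and> (\<forall>R'. (\<exists>a b z. conf R' a b z) \<longrightarrow> card R' \<le> card R)"
  proof (intro ex_has_greatest_nat[of _ _ card "Suc (card V)"])
    show "\<forall>R. (\<exists>a b z. conf R a b z) \<longrightarrow> card R < Suc (card V)"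
      unfolding conf_def using finite_V by (auto intro!: card_mono le_imp_less_Suc)
  qed blast
  then obtain R a b z where conf: "conf R a b z"
    and max: "\<And>R' a b z. conf R' a b z \<Longrightarrow> card R' \<le> card R"
    by blast
  note conf' = conf[unfolded conf_def]
  define S where "S = outer a b z"
  define K where "K = V - S - R"
  have finR: "finite R"
    using conf' finite_V finite_subset by blast
  have ab: "a \<in> R" "b \<in> R"
    using conf' grows_subset by blast+
  have K_R: "\<not> E k y" if "k \<in> K" "y \<in> R" for k y
  proof
    assume "E k y"
    then have "conf (insert k R) a b z"
      using conf' that grows_step unfolding conf_def K_def S_def by auto
    then show False
      using max[of "insert k R"] that finR unfolding K_def by simp
  qed
  have S_ab: "E s a \<or> E s b" if "s \<in> S" for s
    using that E_sym unfolding S_def outer_def nbrs_def by blast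
  have SR: "S \<inter> R = {}" using conf' unfolding S_def by blast
  have SV: "S \<subseteq> V" unfolding S_def outer_def using nbrs_subset by blast
  have S_unique: "s = s'" if "k \<in> K" "s \<in> S" "s' \<in> S" "E k s" "E k s'" for k s s'
    using outer_nbr_unique[of a b k s z s'] conf' ab that unfolding K_def S_def by blast
  have K_nbr: "y \<in> K \<or> y \<in> S" if "k \<in> K" "E k y" for k y
    using that K_R E_V2 unfolding K_def by blast
  \<comment> \<open>Here \<open>X\<close> is a path from a new edge in \<open>K\<close> back to \<open>R\<close>.\<close>
  have no_larger: False
    if "a' \<in> K" "b' \<in> K" "deg a' = 4" "E a' b'" "E a' z'" "z' \<noteq> b'"
      and X: "a \<in> X" "b \<in> X" "X \<subseteq> V" "X \<inter> outer a' b' z' = {}" "grows {a', b'} X"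
    for a' b' z' X
  proof -
    have "outer a' b' z' \<inter> R = {}"
      using that(1,2) K_R unfolding outer_def nbrs_def by blast
    moreover have "grows {a', b'} (R \<union> X)"
      using grows_union[of "{a, b}" R "{a', b'}" X] conf' X by blast
    ultimately have "conf (R \<union> X) a' b' z'"
      using that conf' unfolding conf_def by blast
    then have "card (R \<union> X) \<le> card R" by (rule max)
    moreover have "a' \<in> X" using grows_subset X(5) by blast
    then have "R \<subset> R \<union> X" using that(1) unfolding K_def by blast
    ultimately show False
      using psubset_card_mono[of "R \<union> X" R] X(3) finR finite_V finite_subset[of X V] by fastforce
  qed
  have "K = {}"
  proof (rule ccontr)
    assume "K \<noteq> {}"
    then have "V - K \<noteq> V" "V - K \<noteq> {}"
      using ab conf' unfolding K_def by blast+
    then obtain k s where k: "k \<in> K" and s: "s \<in> S" and ks: "E k s"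
      using connected[of "V - K"] K_nbr unfolding K_def by blast
    have sk: "E s k" using ks E_sym by blast
    have sV: "s \<in> V" "k \<in> V" using ks E_V E_V2 by blast+
    have abV: "a \<in> V" "b \<in> V" using ab conf' by blast+
    have ba: "E a b" "E b a" using conf' E_sym by blast+
    have to_ab: "grows H (insert a (insert b W))" if "grows H W" "s \<in> W" for H W
    proof (cases "E a s")
      case True
      then have "grows H (insert b (insert a W))"
        using grows_step[OF grows_step[OF that True], of a b] ba by blast
      then show ?thesis by (simp add: insert_commute)
    next
      case False
      then have "E b s" using S_ab s E_sym by blast
      then show ?thesis
        using grows_step[OF grows_step[OF that], of b b a] ba by blast
    qed
    have SK: "s \<notin> K" "a \<notin> K" "b \<notin> K"
      using s ab unfolding K_def by blast+
    show False
    proof (cases "deg k = 4")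
      case True
      then have "card (nbrs k - {s}) = 3"
        using ks by (simp add: nbrs_def)
      then obtain b' where b': "E k b'" "b' \<noteq> s"
        by (metis Diff_iff all_not_in_conv card.empty insert_iff mem_Collect_eq nbrs_def
            numeral_3_eq_3 zero_neq_numeral)
      have b'K: "b' \<in> K"
        using K_nbr[OF k b'(1)] S_unique[OF k s _ ks b'(1)] b'(2) by blast
      show False
      proof (rule no_larger[of k b' s "insert a (insert b (insert s {k, b'}))"])
        show "insert a (insert b (insert s {k, b'})) \<inter> outer k b' s = {}"
          using no_triangle[of k b' s] b' sk E_irrefl k b'K K_R ab
          unfolding outer_def nbrs_def by blast
        show "grows {k, b'} (insert a (insert b (insert s {k, b'})))"
          by (rule to_ab[OF grows_step[OF grows.base _ sk]]) auto
      qed (use k b'K True ks b' abV sV in \<open>auto simp: K_def\<close>)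
    next
      case False
      then have deg_k: "deg k = 3" using deg_cases sV by blast
      then have "card (nbrs k - {s}) = 2"
        using ks by (simp add: nbrs_def)
      then obtain x1 x2 where x12: "nbrs k - {s} = {x1, x2}" "x1 \<noteq> x2"
        by (auto simp: card_2_iff)
      then have "E k x1" "E k x2" by (auto simp: nbrs_def)
      then have "deg x1 = 4 \<or> deg x2 = 4"
        using deg_4_if_two_nbrs[OF deg_k] x12(2) deg_cases E_V2 by metis
      then obtain x where x: "E k x" "x \<noteq> s" "deg x = 4"
        using x12 by (auto simp: nbrs_def)
      have xk: "E x k" using x E_sym by blast
      have xK: "x \<in> K"
        using K_nbr[OF k x(1)] S_unique[OF k s _ ks x(1)] x(2) by blast
      have "card (nbrs x - {k}) = 3"
        using x(3) xk by (simp add: nbrs_def)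
      then obtain y1 y2 y3 where y: "nbrs x - {k} = {y1, y2, y3}" "y1 \<noteq> y2"
        by (auto simp: card_3_iff)
      then have Ey: "E x y1" "E x y2" by (auto simp: nbrs_def)
      then have "y1 \<in> K \<or> y2 \<in> K"
        using K_nbr[OF xK] S_unique[OF xK _ _ Ey] y(2) by blast
      then obtain b' where b': "b' \<in> K" "E x b'" "b' \<noteq> k"
        using y Ey by (auto simp: nbrs_def)
      show False
      proof (rule no_larger[of x b' k "insert a (insert b (insert s (insert k {x, b'})))"])
        show "insert a (insert b (insert s (insert k {x, b'}))) \<inter> outer x b' k = {}"
        proof -
          have "\<not> E b' k" "\<not> E x s" "\<not> E b' s"
            using no_triangle[of x b' k] no_triangle[of x k s] no_4_cycle[of b' x k s]
              b' x ks xk sk E_sym SK by blast+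
          then show ?thesis
            using K_R[OF xK] K_R[OF b'(1)] ab E_irrefl xk
            unfolding outer_def nbrs_def by blast
        qed
        show "grows {x, b'} (insert a (insert b (insert s (insert k {x, b'}))))"
          by (rule to_ab[OF grows_step[OF grows_step[OF grows.base _ x(1)] _ sk]]) auto
      qed (use xK b' x xk abV sV in \<open>auto simp: K_def\<close>)
    qed
  qed
  then have "R = V - outer a b z"
    using conf' unfolding K_def S_def by blast
  then show ?thesis using conf' by blast
qed

text \<open>
  The colours of \<open>x1, y1\<close> are chosen so that each of \<open>a\<close> and \<open>b\<close> loses at most one colour to them,
  those of \<open>x2, y2\<close> so that \<open>a\<close> loses at most one colour to them. The latter must avoid one colour
  each, and if the at least 10 colours left for either are disjoint, they cannot all be among the
  11 of \<open>a\<close>. When \<open>b\<close> is coloured, with \<open>a\<close> to follow, it has lost at most \<open>1 + 2\<close> colours to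
  these four vertices and at most 7 to its other coloured square neighbours. Finally \<open>a\<close> has lost
  at most \<open>1 + 1\<close> and 8.
\<close>

lemma contradiction: False
proof -
  obtain a b z where a: "deg a = 4" and ab: "E a b" and z: "E a z" "z \<noteq> b"
    and grows: "grows {a, b} (V - outer a b z)"
    using ex_connected_complement by blast
  have b: "deg b = 3" using deg_3_if_edge ab a by blast
  have ba: "E b a" using ab E_sym by blast
  have abV: "a \<in> V" "b \<in> V" using ab E_V E_V2 by blast+
  have "card (nbrs a - {b, z}) = 2"
    using a ab z by (subst card_Diff_subset) (auto simp: nbrs_def)
  then obtain x1 x2 where x: "nbrs a - {b, z} = {x1, x2}" "x1 \<noteq> x2"
    by (auto simp: card_2_iff)
  have "card (nbrs b - {a}) = 2"
    using b ba by (simp add: nbrs_def)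
  then obtain y1 y2 where y: "nbrs b - {a} = {y1, y2}" "y1 \<noteq> y2"
    by (auto simp: card_2_iff)
  define S where "S = {x1, x2, y1, y2}"
  have S: "outer a b z = S"
    unfolding outer_def S_def using x y by auto
  have far: "p \<noteq> q" "\<not> sq p q" if "p \<in> {x1, x2}" "q \<in> {y1, y2}" for p q
  proof -
    have p: "E a p" "E p a" "p \<noteq> b" and q: "E b q" "E q b" "q \<noteq> a"
      using that x y E_sym by (auto simp: nbrs_def)
    show "p \<noteq> q"
      using no_triangle[of a b p] ab p q by blast
    have "\<not> E p q"
      using no_4_cycle[of a p q b] ab ba p q E_sym by blast
    moreover have "\<not> (E p m \<and> E m q)" for m
      using no_5_cycle[of a p m q b] ba p q by blast
    ultimately show "\<not> sq p q" unfolding sq_def by blast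
  qed
  have Ea: "E a x1" "E a x2" and Eb: "E b y1" "E b y2"
    using x y by (auto simp: nbrs_def)
  have SV: "x1 \<in> V" "x2 \<in> V" "y1 \<in> V" "y2 \<in> V"
    using Ea Eb E_V2 by blast+
  have abS: "a \<notin> S" "b \<notin> S"
    using x y E_irrefl unfolding S_def nbrs_def by blast+
  have S_V: "S \<subseteq> V" using SV unfolding S_def by blast
  have card_S: "card S = 4"
    using x(2) y(2) far(1)[of x1 y1] far(1)[of x1 y2] far(1)[of x2 y1] far(1)[of x2 y2]
    unfolding S_def by (simp add: card_insert_if)
  have S_sq: "S \<subseteq> sq_nbrs a" "S \<subseteq> sq_nbrs b"
  proof -
    have "sq a s \<and> sq b s" if "s \<in> S" for s
      using that sq_edge[OF Ea(1)] sq_edge[OF Ea(2)] sq_edge[OF Eb(1)] sq_edge[OF Eb(2)]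
        sq_path[OF ba Ea(1)] sq_path[OF ba Ea(2)] sq_path[OF ab Eb(1)] sq_path[OF ab Eb(2)] abS
      unfolding S_def by auto
    then show "S \<subseteq> sq_nbrs a" "S \<subseteq> sq_nbrs b" unfolding sq_nbrs_def by blast+
  qed
  obtain c1 d1 where 1: "c1 \<in> L x1" "d1 \<in> L y1"
    "card ({c1, d1} \<inter> L a) \<le> 1" "card ({c1, d1} \<inter> L b) \<le> 1"
    using two_colours_meeting_two_lists_once[of "L x1" "L y1" "L a" "L b" 11]
      finite_L card_L SV abV by auto
  have "\<exists>c\<in>L x2 - {c1}. \<exists>d\<in>L y2 - {d1}. card ({c, d} \<inter> L a) \<le> 1"
  proof (rule two_colours_meeting_list_once)
    have le: "10 \<le> card (L v - {c})" if "v \<in> V" for v c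
      using diff_card_le_card_Diff[of "{c}" "L v"] card_L[OF that] by simp
    show "card (L a) < card (L x2 - {c1}) + card (L y2 - {d1})"
      using le[of x2 c1] le[of y2 d1] card_L SV abV by simp
    show "L x2 - {c1} \<noteq> {}" "L y2 - {d1} \<noteq> {}"
      using le[of x2 c1] le[of y2 d1] SV by fastforce+
  qed (use finite_L SV abV in auto)
  then obtain c2 d2 where 2: "c2 \<in> L x2" "c2 \<noteq> c1" "d2 \<in> L y2" "d2 \<noteq> d1"
    "card ({c2, d2} \<inter> L a) \<le> 1"
    by blast
  define f where "f = (\<lambda>_. c1)(x2 := c2, y1 := d1, y2 := d2)"
  have f: "f x1 = c1" "f x2 = c2" "f y1 = d1" "f y2 = d2"
    using x(2) y(2) far(1)[of x1 y1] far(1)[of x1 y2] far(1)[of x2 y1] far(1)[of x2 y2]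
    unfolding f_def by auto
  have "f s \<noteq> f t" if "s \<in> S" "t \<in> S" "sq s t" for s t
  proof -
    have "\<not> sq s s" unfolding sq_def by simp
    then have "{s, t} = {x1, x2} \<or> {s, t} = {y1, y2}"
      using that far(2)[of s t] far(2)[of t s] sq_sym[of s t] unfolding S_def by auto
    then show ?thesis
      using f 2(2,4) by (auto simp: doubleton_eq_iff)
  qed
  then have "proper f S"
    unfolding proper_def using f 1 2 unfolding S_def by auto
  moreover have "V - (V - S) = S"
    using SV unfolding S_def by blast
  ultimately have "proper f (V - (V - S))" by simp
  moreover have "\<forall>h\<in>{a, b}. \<exists>k\<in>{a, b}. E h k" using ab ba by blast
  ultimately obtain g where g: "proper g (V - {a, b})" "\<forall>s\<in>S. g s = f s"
    using extend_along_growth[OF grows] S \<open>V - (V - S) = S\<close> by (metis Diff_subset)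
  have used: "card (h ` D \<inter> L v) \<le> 10"
    if h: "\<forall>s\<in>S. h s = f s" and D: "S \<subseteq> D" "finite D"
      and c: "card ({c1, d1} \<inter> L v) \<le> 1" "card ({c2, d2} \<inter> L v) + card D \<le> 13" for h D v
  proof -
    have "h ` D = {c1, d1} \<union> {c2, d2} \<union> h ` (D - S)"
    proof -
      have "h ` S = {c1, d1} \<union> {c2, d2}"
        using h f unfolding S_def by auto
      moreover have "h ` D = h ` S \<union> h ` (D - S)" using D(1) by blast
      ultimately show ?thesis by simp
    qed
    then have "h ` D \<inter> L v \<subseteq> ({c1, d1} \<inter> L v) \<union> ({c2, d2} \<inter> L v) \<union> h ` (D - S)"
      by blast
    then have "card (h ` D \<inter> L v) \<le> card (({c1, d1} \<inter> L v) \<union> ({c2, d2} \<inter> L v) \<union> h ` (D - S))"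
      using D(2) by (intro card_mono) auto
    also have "\<dots> \<le> card ({c1, d1} \<inter> L v) + card ({c2, d2} \<inter> L v) + card (h ` (D - S))"
      by (intro order.trans[OF card_Un_le] add_mono card_Un_le order.refl)
    also have "card (h ` (D - S)) \<le> card (D - S)"
      using D by (intro card_image_le) auto
    also have "card (D - S) = card D - 4"
      using D card_S by (metis card_Diff_subset finite_subset)
    finally show ?thesis
      using c card_S card_mono[OF D(2,1)] by linarith
  qed
  have "card (g ` (sq_nbrs b \<inter> (V - {a, b})) \<inter> L b) \<le> 10"
  proof (rule used)
    have "a \<in> sq_nbrs b" using sq_edge[OF ba] by (simp add: sq_nbrs_def)
    then have "card (sq_nbrs b - {a}) \<le> 11" using card_sq_nbrs_le_12[of b] by simp
    moreover have "card (sq_nbrs b \<inter> (V - {a, b})) \<le> card (sq_nbrs b - {a})"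
      by (intro card_mono) auto
    moreover have "card ({c2, d2} \<inter> L b) \<le> card {c2, d2}" by (intro card_mono) auto
    moreover have "card {c2, d2} \<le> 2" by (simp add: card_insert_if)
    ultimately show "card ({c2, d2} \<inter> L b) + card (sq_nbrs b \<inter> (V - {a, b})) \<le> 13" by linarith
  qed (use g 1 S_sq abS S_V in auto)
  then obtain c where c: "c \<in> avail g (V - {a, b}) b"
    using avail_nonempty[OF abV(2)] by blast
  have g': "proper (g(b := c)) (insert b (V - {a, b}))"
    by (rule proper_fun_upd[OF g(1) _ c]) simp
  have "card ((g(b := c)) ` (sq_nbrs a \<inter> insert b (V - {a, b})) \<inter> L a) \<le> 10"
  proof (rule used)
    have "card (sq_nbrs a \<inter> insert b (V - {a, b})) \<le> card (sq_nbrs a)"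
      by (intro card_mono) auto
    then show "card ({c2, d2} \<inter> L a) + card (sq_nbrs a \<inter> insert b (V - {a, b})) \<le> 13"
      using 2(5) card_sq_nbrs_le_12[of a] by linarith
  qed (use g 1 S_sq abS S_V in auto)
  then obtain d where d: "d \<in> avail (g(b := c)) (insert b (V - {a, b})) a"
    using avail_nonempty[OF abV(1)] by blast
  have "a \<noteq> b" using ab E_irrefl by blast
  then have "proper (g(b := c, a := d)) (insert a (insert b (V - {a, b})))"
    using proper_fun_upd[OF g' _ d] by simp
  also have "insert a (insert b (V - {a, b})) = V"
    using abV by blast
  finally show False using not_colourable by blast
qed

end

section \<open>Gluing the components\<close>

context pair_graph
begin

lemma arc_sym: "(u, v) \<in> parcs G \<Longrightarrow> (v, u) \<in> parcs G"
  using pair_sym_arcs by (auto simp: symmetric_def sym_def)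

lemma degree_eq_card: "degree G v = card {u. (v, u) \<in> parcs G}"
proof -
  have "out_arcs (with_proj G) v = Pair v ` {u. (v, u) \<in> parcs G}"
    by (auto simp: out_arcs_def)
  then show ?thesis
    unfolding out_degree_def by (simp add: card_image inj_on_def)
qed

lemma square_arcD:
  "(u, v) \<in> parcs (square G) \<Longrightarrow>
    u \<noteq> v \<and> ((u, v) \<in> parcs G \<or> (\<exists>w. (u, w) \<in> parcs G \<and> (w, v) \<in> parcs G))"
  unfolding square_def using distance_eq_2_iff pair_no_loops by fastforce

definition component :: "'a \<Rightarrow> 'a set" where
  "component v = {u. (v, u) \<in> (parcs G)\<^sup>*}"

lemma component_arc:
  assumes "(x, y) \<in> parcs G"
  shows "component x = component y"
  unfolding component_def using assms arc_sym by (auto intro: converse_rtrancl_into_rtrancl)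

text \<open>
  A square arc joins vertices of the same component, and the square of a component, formed with
  the edges inside it, contains all square arcs between its vertices.
\<close>

lemma component_colourable:
  fixes L :: "'a \<Rightarrow> 'c set"
  assumes irr: "irregular 4 G" and v: "v \<in> pverts G"
    and L: "\<And>x. x \<in> pverts G \<Longrightarrow> finite (L x) \<and> card (L x) = 11"
  shows "\<exists>f. (\<forall>x\<in>component v. f x \<in> L x) \<and>
    (\<forall>x\<in>component v. \<forall>y\<in>component v. (x, y) \<in> parcs (square G) \<longrightarrow> f x \<noteq> f y)"
proof (rule ccontr)
  assume no_colouring: "\<not> ?thesis"
  define C where "C = component v"
  define E where "E x y \<longleftrightarrow> x \<in> C \<and> (x, y) \<in> parcs G" for x y
  have CV: "C \<subseteq> pverts G"
  proof
    fix u assume "u \<in> C"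
    then have "(v, u) \<in> (parcs G)\<^sup>*" by (simp add: C_def component_def)
    then show "u \<in> pverts G"
      by (induction rule: rtrancl_induct) (use v in_arcsD2 in auto)
  qed
  have closed: "y \<in> C" if "x \<in> C" "(x, y) \<in> parcs G" for x y
    using that unfolding C_def component_def by (auto intro: rtrancl_into_rtrancl)
  interpret fg: finite_graph C E
  proof
    show "finite C" using CV pair_finite_verts finite_subset by blast
    show "E u w \<Longrightarrow> u \<in> C" for u w by (simp add: E_def)
    show "E u w \<Longrightarrow> E w u" for u w
      unfolding E_def using closed arc_sym by blast
    show "\<not> E u u" for u
      unfolding E_def using pair_no_loops by fastforce
  qed
  have max: "degree G x \<le> 4" if "x \<in> pverts G" for x
  proof -
    have "degree G x \<le> max_degree G"
      unfolding max_degree_def using that pair_finite_verts by (intro Max_ge) auto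
    then show ?thesis using irr unfolding irregular_def by simp
  qed
  have deg: "fg.deg x = degree G x" if "x \<in> C" for x
    unfolding fg.nbrs_def degree_eq_card E_def using that by simp
  interpret counterexample C E L
  proof unfold_locales
    show "fg.deg x \<le> 4" for x
    proof (cases "x \<in> C")
      case True
      then show ?thesis using deg max CV by auto
    next
      case False
      then show ?thesis by (simp add: fg.nbrs_def E_def)
    qed
    show "fg.deg w \<noteq> 4" if "E u w" "fg.deg u = 4" for u w
      using that irr deg[of u] deg[of w] closed[of u w] CV
      unfolding E_def irregular_def by fastforce
    show "finite (L x)" "card (L x) = 11" if "x \<in> C" for x
      using L CV that by blast+
    show "\<exists>x\<in>C - W. \<exists>y\<in>W. E x y" if W: "W \<subseteq> C" "W \<noteq> {}" "W \<noteq> C" for W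
    proof (rule ccontr)
      assume no_edge: "\<not> ?thesis"
      obtain w where w: "w \<in> W" using W(2) by blast
      have "u \<in> W" if "(w, u) \<in> (parcs G)\<^sup>*" for u
        using that
      proof (induction rule: rtrancl_induct)
        case (step y z)
        then show ?case
          using no_edge closed[of y z] W(1) arc_sym[of y z] unfolding E_def by blast
      qed (rule w)
      moreover have "(w, v) \<in> (parcs G)\<^sup>*"
      proof -
        have "(v, w) \<in> (parcs G)\<^sup>*"
          using w W(1) by (auto simp: C_def component_def)
        moreover have "sym ((parcs G)\<^sup>*)"
          using arc_sym by (intro sym_rtrancl) (auto simp: sym_def)
        ultimately show ?thesis by (rule symD[rotated])
      qed
      ultimately have "C \<subseteq> W"
        unfolding C_def component_def by (auto intro: rtrancl_trans)
      with W show False by blast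
    qed
    show "\<not> list_assignment.proper E L f C" for f
    proof
      assume "list_assignment.proper E L f C"
      moreover have "list_assignment C E L"
        by unfold_locales fact+
      ultimately have f: "\<forall>x\<in>C. f x \<in> L x" "\<forall>x\<in>C. \<forall>y\<in>C. fg.sq x y \<longrightarrow> f x \<noteq> f y"
        by (simp_all add: list_assignment.proper_def)
      have "fg.sq x y" if "x \<in> C" "(x, y) \<in> parcs (square G)" for x y
        using square_arcD[OF that(2)] closed[OF that(1)] that(1)
        unfolding fg.sq_def E_def by blast
      with f no_colouring show False
        unfolding C_def by blast
    qed
  qed
  show False by (rule contradiction)
qed

lemma square_11_choosable:
  assumes "irregular 4 G"
  shows "choosable 11 (square G)"
  unfolding choosable_def
proof (intro allI impI)
  fix L :: "'a \<Rightarrow> nat set"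
  assume "\<forall>v\<in>pverts (square G). finite (L v) \<and> card (L v) = 11"
  then have L: "finite (L v) \<and> card (L v) = 11" if "v \<in> pverts G" for v
    using that by (simp add: square_def)
  define good where "good C f \<longleftrightarrow> (\<forall>x\<in>C. f x \<in> L x) \<and>
    (\<forall>x\<in>C. \<forall>y\<in>C. (x, y) \<in> parcs (square G) \<longrightarrow> f x \<noteq> f y)" for C f
  define F where "F C = (SOME f. good C f)" for C
  have F: "good (component v) (F (component v))" if "v \<in> pverts G" for v
  proof -
    have "\<exists>f. good (component v) f"
      using component_colourable[of v L, OF assms that] L unfolding good_def by blast
    then show ?thesis
      unfolding F_def by (rule someI_ex)
  qed
  have self: "x \<in> component x" for x
    by (simp add: component_def)
  have "proper_coloring (square G) (\<lambda>x. F (component x) x)"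
    unfolding proper_coloring_def
  proof (clarify)
    fix x y
    assume xy: "(x, y) \<in> parcs (square G)" and eq: "F (component x) x = F (component y) y"
    have "component x = component y"
      using square_arcD[OF xy] component_arc by metis
    moreover have "x \<in> pverts G"
      using square_arcD[OF xy] in_arcsD1 by blast
    ultimately show False
      using F[of x] self[of x] self[of y] xy eq unfolding good_def by metis
  qed
  moreover have "\<forall>v\<in>pverts (square G). F (component v) v \<in> L v"
    using F self by (auto simp: square_def good_def)
  ultimately show "list_colorable (square G) L"
    unfolding list_colorable_def by blast
qed

end

theorem theorem2p1:
  fixes G :: "'a pair_pre_digraph"
  assumes "pair_graph G"
    and "irregular 4 G"
  shows "list_chromatic_number (square G) \<le> 11"
  unfolding list_chromatic_number_def
  using pair_graph.square_11_choosable[OF assms] by (rule Least_le)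

end
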